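(* Let $T:\mathcal{B}(\mathcal{H})\to\mathcal{B}(\mathcal{H})$ be a Markov operator and $q\in\mathcal{B}(\mathcal{H})$ an orthogonal projection with $T(q)\le q$ such that $q\mathcal{H}$ is separable. Then the following are equivalent: (i) There is a potential $y$ for $T$ such that $q=\operatorname{supp}y$. (ii) There is an orthonormal basis $(\xi_j)_{j\in J}$ of $q\mathcal{H}$ such that each rank one operator $t_{\xi_j}$ is $T$-summable. (iii) There is an orthonormal basis $(\xi_j)_{j\in J}$ of $q\mathcal{H}$ such that $\sum_{n=0}^\infty\langle T^n(t_{\xi_j})\eta_0,\eta_0\rangle<\infty$ for all $j\in J$ and all $\eta_0\in q\mathcal{H}$.
   Context: A Markov operator is a normal completely positive unital linear map. For $\xi\in\mathcal{H}$, $t_\xi$ denotes the operator $\eta\mapsto\langle\eta,\xi\rangle\xi$. An element $x\ge0$ is $T$-summable if $\sum_{n\ge0}T^n(x)$ converges strongly to a bounded operator; $y\ge0$ is a potential if $y=\sum_{n\ge0}T^n(x)$ for some $T$-summable $x$. $\operatorname{supp}y$ is the projection onto the closure of the range of $y$. *)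

theory Defs
  imports "HOL-Analysis.Analysis"
begin

text \<open>A complex Hilbert space: a real Banach space carrying a complex scalar
 multiplication extending the real one and a complex inner product, linear in the
 FIRST argument (as in the paper: t_xi eta = <eta,xi> xi), inducing the norm.\<close>

class chilbert = banach +
  fixes scaleC :: "complex \<Rightarrow> 'a \<Rightarrow> 'a"
    and cinner :: "'a \<Rightarrow> 'a \<Rightarrow> complex"
  assumes scaleC_add_right: "scaleC c (x + y) = scaleC c x + scaleC c y"
    and scaleC_add_left: "scaleC (c + d) x = scaleC c x + scaleC d x"
    and scaleC_scaleC: "scaleC c (scaleC d x) = scaleC (c * d) x"
    and scaleC_one: "scaleC 1 x = x"
    and scaleR_scaleC: "scaleR r x = scaleC (complex_of_real r) x"
    and cinner_commute: "cinner x y = cnj (cinner y x)"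
    and cinner_add_left: "cinner (x + y) z = cinner x z + cinner y z"
    and cinner_scaleC_left: "cinner (scaleC c x) y = c * cinner x y"
    and cinner_self_norm: "cinner x x = complex_of_real ((norm x)\<^sup>2)"

definition clinear_op :: "('h::chilbert \<Rightarrow> 'h) \<Rightarrow> bool" where
  "clinear_op A \<longleftrightarrow> (\<forall>x y. A (x + y) = A x + A y) \<and> (\<forall>c x. A (scaleC c x) = scaleC c (A x))"

definition bounded_op :: "('h::chilbert \<Rightarrow> 'h) \<Rightarrow> bool" where
  "bounded_op A \<longleftrightarrow> clinear_op A \<and> (\<exists>K. \<forall>x. norm (A x) \<le> K * norm x)"

definition op_pos :: "('h::chilbert \<Rightarrow> 'h) \<Rightarrow> bool" where
  "op_pos A \<longleftrightarrow> bounded_op A \<and> (\<forall>x. cinner (A x) x \<in> \<real> \<and> 0 \<le> Re (cinner (A x) x))"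

definition op_le :: "('h::chilbert \<Rightarrow> 'h) \<Rightarrow> ('h \<Rightarrow> 'h) \<Rightarrow> bool" where
  "op_le A B \<longleftrightarrow> bounded_op A \<and> op_pos (\<lambda>x. B x - A x)"

definition is_orth_proj :: "('h::chilbert \<Rightarrow> 'h) \<Rightarrow> bool" where
  "is_orth_proj p \<longleftrightarrow> bounded_op p \<and> p \<circ> p = p \<and> (\<forall>x y. cinner (p x) y = cinner x (p y))"

definition is_op_sup :: "('h::chilbert \<Rightarrow> 'h) set \<Rightarrow> ('h \<Rightarrow> 'h) \<Rightarrow> bool" where
  "is_op_sup D s \<longleftrightarrow> bounded_op s \<and> (\<forall>a\<in>D. op_le a s) \<and>
     (\<forall>u. bounded_op u \<and> (\<forall>a\<in>D. op_le a u) \<longrightarrow> op_le s u)"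

definition op_map_linear :: "(('h::chilbert \<Rightarrow> 'h) \<Rightarrow> ('h \<Rightarrow> 'h)) \<Rightarrow> bool" where
  "op_map_linear T \<longleftrightarrow>
     (\<forall>A. bounded_op A \<longrightarrow> bounded_op (T A)) \<and>
     (\<forall>A B. bounded_op A \<and> bounded_op B \<longrightarrow> T (\<lambda>x. A x + B x) = (\<lambda>x. T A x + T B x)) \<and>
     (\<forall>c A. bounded_op A \<longrightarrow> T (\<lambda>x. scaleC c (A x)) = (\<lambda>x. scaleC c (T A x)))"

definition block_pos :: "nat \<Rightarrow> (nat \<Rightarrow> nat \<Rightarrow> ('h::chilbert \<Rightarrow> 'h)) \<Rightarrow> bool" where
  "block_pos n A \<longleftrightarrow> (\<forall>x :: nat \<Rightarrow> 'h.
     (\<Sum>i<n. \<Sum>j<n. cinner (A i j (x j)) (x i)) \<in> \<real> \<and>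
     0 \<le> Re (\<Sum>i<n. \<Sum>j<n. cinner (A i j (x j)) (x i)))"

definition completely_positive :: "(('h::chilbert \<Rightarrow> 'h) \<Rightarrow> ('h \<Rightarrow> 'h)) \<Rightarrow> bool" where
  "completely_positive T \<longleftrightarrow> (\<forall>n A. (\<forall>i<n. \<forall>j<n. bounded_op (A i j)) \<and> block_pos n A
      \<longrightarrow> block_pos n (\<lambda>i j. T (A i j)))"

text \<open>Normality: T preserves suprema of bounded increasing nets of positive operators
  (nets are represented by their ranges, i.e. nonempty upward directed sets).\<close>
definition normal_map :: "(('h::chilbert \<Rightarrow> 'h) \<Rightarrow> ('h \<Rightarrow> 'h)) \<Rightarrow> bool" where
  "normal_map T \<longleftrightarrow> (\<forall>D s. D \<noteq> {} \<and> (\<forall>a\<in>D. op_pos a) \<and>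
      (\<forall>a\<in>D. \<forall>b\<in>D. \<exists>c\<in>D. op_le a c \<and> op_le b c) \<and> is_op_sup D s
      \<longrightarrow> is_op_sup (T ` D) (T s))"

definition markov_op :: "(('h::chilbert \<Rightarrow> 'h) \<Rightarrow> ('h \<Rightarrow> 'h)) \<Rightarrow> bool" where
  "markov_op T \<longleftrightarrow> op_map_linear T \<and> completely_positive T \<and> T id = id \<and> normal_map T"

definition t_vec :: "'h::chilbert \<Rightarrow> ('h \<Rightarrow> 'h)" where
  "t_vec \<xi> = (\<lambda>\<eta>. scaleC (cinner \<eta> \<xi>) \<xi>)"

definition T_summable :: "(('h::chilbert \<Rightarrow> 'h) \<Rightarrow> ('h \<Rightarrow> 'h)) \<Rightarrow> ('h \<Rightarrow> 'h) \<Rightarrow> bool" where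
  "T_summable T x \<longleftrightarrow> op_pos x \<and>
     (\<exists>y. bounded_op y \<and> (\<forall>\<eta>. (\<lambda>n. (T ^^ n) x \<eta>) sums y \<eta>))"

definition potential :: "(('h::chilbert \<Rightarrow> 'h) \<Rightarrow> ('h \<Rightarrow> 'h)) \<Rightarrow> ('h \<Rightarrow> 'h) \<Rightarrow> bool" where
  "potential T y \<longleftrightarrow> op_pos y \<and>
     (\<exists>x. T_summable T x \<and> (\<forall>\<eta>. (\<lambda>n. (T ^^ n) x \<eta>) sums y \<eta>))"

definition supp :: "('h::chilbert \<Rightarrow> 'h) \<Rightarrow> ('h \<Rightarrow> 'h)" where
  "supp y = (THE p. is_orth_proj p \<and> range p = closure (range y))"

definition cspan :: "'h::chilbert set \<Rightarrow> 'h set" where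
  "cspan S = {(\<Sum>v\<in>F. scaleC (c v) v) | F c. finite F \<and> F \<subseteq> S}"

definition is_onb :: "'h::chilbert set \<Rightarrow> 'h set \<Rightarrow> bool" where
  "is_onb B M \<longleftrightarrow> B \<subseteq> M \<and> (\<forall>x\<in>B. norm x = 1) \<and>
     (\<forall>x\<in>B. \<forall>y\<in>B. x \<noteq> y \<longrightarrow> cinner x y = 0) \<and> closure (cspan B) = M"

definition separable_set :: "'a::topological_space set \<Rightarrow> bool" where
  "separable_set M \<longleftrightarrow> (\<exists>D. countable D \<and> D \<subseteq> M \<and> M \<subseteq> closure D)"

end

theory Submission
  imports Defs
begin

text \<open>
  Everything is expressed through the quadratic forms \<open>\<langle>A\<eta>,\<eta>\<rangle>\<close> of positive operators: by
  Cauchy-Schwarz and completeness, a positive \<open>x\<close> is summable iff the forms of the partial sums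
  of \<open>\<Sum>T\<^sup>n x\<close> are bounded by a multiple of \<open>\<parallel>\<eta>\<parallel>\<^sup>2\<close>, so summability is inherited by dominated
  operators.

  If \<open>y = \<Sum>T\<^sup>n x\<close> has support \<open>q\<close>, then \<open>t\<^bsub>A\<zeta>\<^esub> \<le> \<langle>A\<zeta>,\<zeta>\<rangle> A\<close> for \<open>A = T\<^sup>n x\<close> shows that the
  subspace of vectors with summable rank one operator is dense in the range of \<open>q\<close>, and
  Gram-Schmidt yields the basis. Conversely a rapidly decreasing combination of the \<open>t\<^bsub>\<xi> j\<^esub>\<close> is
  summable and its potential has support \<open>q\<close>. Finally \<open>T(q) \<le> q\<close> confines \<open>T\<^sup>n t\<^bsub>\<xi>\<^esub>\<close> to the range
  of \<open>q\<close>, so pointwise summability of the forms there becomes a uniform bound by the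
  Banach-Steinhaus argument.
\<close>

section \<open>Complex Hilbert spaces\<close>

lemma cinner_scaleC_right: "cinner x (scaleC c y) = cnj c * cinner (x::'h::chilbert) y"
  by (metis cinner_commute cinner_scaleC_left complex_cnj_mult)

lemma cinner_add_right: "cinner x (y + z) = cinner x y + cinner (x::'h::chilbert) z"
  by (metis cinner_add_left cinner_commute complex_cnj_add)

lemma additive_cinner_left: "Modules.additive (\<lambda>x. cinner x (z::'h::chilbert))"
  by (simp add: Modules.additive_def cinner_add_left)

lemma additive_cinner_right: "Modules.additive (\<lambda>x. cinner (z::'h::chilbert) x)"
  by (simp add: Modules.additive_def cinner_add_right)

lemmas cinner_zero_left [simp] = Modules.additive.zero [OF additive_cinner_left]
lemmas cinner_zero_right [simp] = Modules.additive.zero [OF additive_cinner_right]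
lemmas cinner_diff_left = Modules.additive.diff [OF additive_cinner_left]
lemmas cinner_diff_right = Modules.additive.diff [OF additive_cinner_right]
lemmas cinner_sum_left = Modules.additive.sum [OF additive_cinner_left]

lemma Re_cinner_self: "Re (cinner x x) = (norm (x::'h::chilbert))\<^sup>2"
  by (simp add: cinner_self_norm)

lemma cinner_self_eq_0_iff [simp]: "cinner x x = 0 \<longleftrightarrow> (x::'h::chilbert) = 0"
  by (simp add: cinner_self_norm)

lemma norm_scaleC: "norm (scaleC c (x::'h::chilbert)) = norm c * norm x"
proof -
  have "complex_of_real ((norm (scaleC c x))\<^sup>2) = cinner (scaleC c x) (scaleC c x)"
    by (simp only: cinner_self_norm)
  also have "\<dots> = (c * cnj c) * cinner x x"
    by (simp add: cinner_scaleC_left cinner_scaleC_right)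
  also have "\<dots> = complex_of_real ((norm c * norm x)\<^sup>2)"
    by (simp only: complex_norm_square [symmetric] cinner_self_norm power_mult_distrib of_real_mult)
  finally have "(norm (scaleC c x))\<^sup>2 = (norm c * norm x)\<^sup>2"
    using of_real_eq_iff by blast
  then show ?thesis
    by (simp add: power2_eq_iff_nonneg)
qed

lemma scaleC_zero_left [simp]: "scaleC 0 (x::'h::chilbert) = 0"
  using norm_scaleC [of 0 x] by simp

lemma scaleC_zero_right [simp]: "scaleC c (0::'h::chilbert) = 0"
  using norm_scaleC [of c 0] by simp

lemma scaleC_uminus_one: "scaleC (-1) (x::'h::chilbert) = - x"
  using scaleR_scaleC [of "-1" x] by simp

section \<open>Quadratic forms and Cauchy-Schwarz for positive operators\<close>

definition qform :: "('h::chilbert \<Rightarrow> 'h) \<Rightarrow> 'h \<Rightarrow> real"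
  where "qform A x = Re (cinner (A x) x)"

lemma clinear_op_add: "clinear_op A \<Longrightarrow> A (x + y) = A x + A y"
  and clinear_op_scaleC: "clinear_op A \<Longrightarrow> A (scaleC c x) = scaleC c (A x)"
  by (auto simp: clinear_op_def)

lemma clinear_op_diff:
  assumes "clinear_op A"
  shows "A (x - y) = A x - A y"
proof -
  have "Modules.additive A" using assms by (simp add: Modules.additive_def clinear_op_add)
  then show ?thesis by (rule Modules.additive.diff)
qed

lemma bounded_op_clinear: "bounded_op A \<Longrightarrow> clinear_op A"
  by (simp add: bounded_op_def)

lemma op_pos_bounded: "op_pos A \<Longrightarrow> bounded_op A"
  by (simp add: op_pos_def)

lemma op_pos_clinear: "op_pos A \<Longrightarrow> clinear_op A"
  by (simp add: op_pos_def bounded_op_def)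

lemma op_pos_qform_nonneg: "op_pos A \<Longrightarrow> 0 \<le> qform A x"
  by (simp add: op_pos_def qform_def)

lemma op_pos_cinner_eq: "op_pos A \<Longrightarrow> cinner (A x) x = of_real (qform A x)"
  by (simp add: op_pos_def qform_def)

text \<open>Polarization: the form is real at \<open>x + y\<close> and at
  \<open>x + scaleC \<i> y\<close>, which makes the sesquilinear form Hermitian.\<close>

lemma op_pos_selfadjoint:
  assumes "op_pos A"
  shows "cinner (A x) y = cinner x (A y)"
proof -
  note lin = op_pos_clinear [OF assms]
  have im: "Im (cinner (A z) z) = 0" for z
    using assms by (simp add: op_pos_def complex_is_Real_iff)
  have "Im (cinner (A x) y) + Im (cinner (A y) x) = 0"
    using im [of "x + y"] im [of x] im [of y]
    by (simp add: clinear_op_add [OF lin] cinner_add_left cinner_add_right)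
  moreover have "Re (cinner (A y) x) - Re (cinner (A x) y) = 0"
    using im [of "x + scaleC \<i> y"] im [of x] im [of y]
    by (simp add: clinear_op_add [OF lin] clinear_op_scaleC [OF lin] cinner_add_left
        cinner_add_right cinner_scaleC_left cinner_scaleC_right)
  ultimately have "cinner (A x) y = cnj (cinner (A y) x)"
    by (simp add: complex_eq_iff)
  then show ?thesis
    by (metis cinner_commute)
qed

text \<open>The coefficient carries the phase of \<open>b\<close>, so the cross terms become real
  and a quadratic in the real \<open>t\<close> remains. It serves both Cauchy-Schwarz and the
  orthogonality of nearest points.\<close>

lemma qform_diff_scaleC:
  fixes t :: real and x y :: "'h::chilbert"
  assumes "op_pos A"
  defines "b \<equiv> cinner (A x) y"
  shows "qform A (x - scaleC (of_real t * b) y)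
    = qform A x - 2 * t * (cmod b)\<^sup>2 + t\<^sup>2 * (cmod b)\<^sup>2 * qform A y"
proof -
  note lin = op_pos_clinear [OF assms(1)]
  have yx: "cinner (A y) x = cnj b"
    unfolding b_def using op_pos_selfadjoint [OF assms(1), of y x] cinner_commute by metis
  define c where "c = complex_of_real t * b"
  have "cinner (A (x - scaleC c y)) (x - scaleC c y)
    = cinner (A x) x - cnj c * b - c * cnj b + c * cnj c * cinner (A y) y"
    by (simp add: clinear_op_diff [OF lin] clinear_op_scaleC [OF lin] cinner_diff_left
        cinner_diff_right cinner_scaleC_left cinner_scaleC_right yx b_def [symmetric]
        algebra_simps)
  also have "\<dots> = cinner (A x) x - 2 * of_real t * (b * cnj b)
      + (of_real t)\<^sup>2 * (b * cnj b) * cinner (A y) y"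
    by (simp add: c_def power2_eq_square algebra_simps)
  also have "\<dots> = of_real (qform A x - 2 * t * (cmod b)\<^sup>2 + t\<^sup>2 * (cmod b)\<^sup>2 * qform A y)"
    by (simp only: op_pos_cinner_eq [OF assms(1)] complex_norm_square [symmetric] of_real_add
        of_real_diff of_real_mult of_real_power of_real_numeral)
  finally show ?thesis
    unfolding c_def using op_pos_cinner_eq [OF assms(1)] by (metis of_real_eq_iff)
qed

lemma op_pos_Cauchy_Schwarz:
  assumes "op_pos A"
  shows "(cmod (cinner (A x) y))\<^sup>2 \<le> qform A x * qform A y"
proof -
  define b where "b = cinner (A x) y"
  have key: "0 \<le> qform A x - 2 * t * (cmod b)\<^sup>2 + t\<^sup>2 * (cmod b)\<^sup>2 * qform A y" for t :: real
    unfolding b_def qform_diff_scaleC [OF assms, symmetric] by (rule op_pos_qform_nonneg [OF assms])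
  show ?thesis
  proof (cases "qform A y = 0")
    case True
    have "cmod b = 0"
    proof (rule ccontr)
      assume "cmod b \<noteq> 0"
      then have "0 < (cmod b)\<^sup>2" by simp
      \<comment> \<open>With this \<open>t\<close> the right-hand side of \<open>key\<close> is
        \<open>- qform A x - 2\<close>, which is negative.\<close>
      then show False
        using key [of "(qform A x + 1) / (cmod b)\<^sup>2"] True
          op_pos_qform_nonneg [OF assms, of x] by simp
    qed
    then show ?thesis by (simp add: b_def True)
  next
    case False
    then have "0 < qform A y"
      using op_pos_qform_nonneg [OF assms, of y] by simp
    \<comment> \<open>The quadratic is smallest at \<open>t = 1 / qform A y\<close>.\<close>
    then show ?thesis
      using key [of "1 / qform A y"] by (simp add: b_def field_simps power2_eq_square)
  qed
qed

section \<open>Bounded and positive operators: closure properties and norm estimates\<close>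

lemma bounded_op_id: "bounded_op (\<lambda>x. x)"
  unfolding bounded_op_def clinear_op_def by (auto intro!: exI [of _ 1])

lemma op_pos_id: "op_pos (\<lambda>x. x)"
  by (simp add: op_pos_def bounded_op_id cinner_self_norm)

lemma qform_id: "qform (\<lambda>x. x) x = (norm x)\<^sup>2"
  by (simp add: qform_def Re_cinner_self)

lemma cinner_Cauchy_Schwarz: "cmod (cinner x y) \<le> norm (x::'h::chilbert) * norm y"
proof -
  have "(cmod (cinner x y))\<^sup>2 \<le> (norm x * norm y)\<^sup>2"
    using op_pos_Cauchy_Schwarz [OF op_pos_id, of x y] by (simp add: qform_id power_mult_distrib)
  then show ?thesis
    by (simp add: power2_le_iff_abs_le)
qed

lemma bounded_bilinear_cinner: "bounded_bilinear (cinner :: 'h::chilbert \<Rightarrow> 'h \<Rightarrow> complex)"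
  by standard (auto simp: cinner_add_left cinner_add_right cinner_scaleC_left cinner_scaleC_right
      scaleR_scaleC scaleR_conv_of_real intro!: exI [of _ 1] cinner_Cauchy_Schwarz)

lemma bounded_linear_scaleC: "bounded_linear (scaleC c :: 'h::chilbert \<Rightarrow> 'h)"
  by (rule bounded_linear_intro [of _ "norm c"])
    (auto simp: scaleC_add_right scaleR_scaleC scaleC_scaleC norm_scaleC mult.commute)

lemmas tendsto_cinner = bounded_bilinear.tendsto [OF bounded_bilinear_cinner]
lemmas tendsto_scaleC = bounded_linear.tendsto [OF bounded_linear_scaleC]

lemma bounded_op_bounded_linear:
  assumes "bounded_op A"
  shows "bounded_linear A"
proof -
  obtain K where K: "norm (A x) \<le> K * norm x" for x
    using assms by (auto simp: bounded_op_def)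
  show ?thesis
    using assms K
    by (intro bounded_linear_intro [of _ K])
      (auto simp: bounded_op_def clinear_op_def scaleR_scaleC mult.commute)
qed

lemma cinner_eqI: "(\<And>w. cinner x w = cinner y w) \<Longrightarrow> (x::'h::chilbert) = y"
  using cinner_self_eq_0_iff [of "x - y"] by (simp add: cinner_diff_left)

lemma bounded_op_add: "bounded_op A \<Longrightarrow> bounded_op B \<Longrightarrow> bounded_op (\<lambda>x. A x + B x)"
proof -
  assume AB: "bounded_op A" "bounded_op B"
  then obtain K L where K: "norm (A x) \<le> K * norm x" and L: "norm (B x) \<le> L * norm x" for x
    by (auto simp: bounded_op_def)
  have "norm (A x + B x) \<le> (K + L) * norm x" for x
    using norm_triangle_ineq [of "A x" "B x"] K [of x] L [of x] by (simp add: distrib_right)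
  then show ?thesis
    using AB unfolding bounded_op_def clinear_op_def
    by (auto simp: scaleC_add_right)
qed

lemma bounded_op_scaleC:
  assumes "bounded_op A"
  shows "bounded_op (\<lambda>x. scaleC c (A x))"
proof -
  obtain K where K: "norm (A x) \<le> K * norm x" for x
    using assms by (auto simp: bounded_op_def)
  have "norm (scaleC c (A x)) \<le> (norm c * K) * norm x" for x
    using mult_left_mono [OF K [of x], of "norm c"] by (simp add: norm_scaleC mult.assoc)
  then have "\<exists>K. \<forall>x. norm (scaleC c (A x)) \<le> K * norm x"
    by blast
  then show ?thesis
    using assms
    by (simp add: bounded_op_def clinear_op_def scaleC_add_right scaleC_scaleC mult.commute)
qed

lemma bounded_op_diff:
  assumes "bounded_op A" "bounded_op B"
  shows "bounded_op (\<lambda>x. A x - B x)"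
  using bounded_op_add [OF assms(1) bounded_op_scaleC [OF assms(2), of "-1"]]
  by (simp add: scaleC_uminus_one)

lemma bounded_op_zero: "bounded_op (\<lambda>x. 0)"
  unfolding bounded_op_def clinear_op_def by (auto intro!: exI [of _ 0])

lemma bounded_op_sum:
  assumes "\<And>i. i \<in> I \<Longrightarrow> bounded_op (A i)"
  shows "bounded_op (\<lambda>x. \<Sum>i\<in>I. A i x)"
  using assms by (induction I rule: infinite_finite_induct) (auto intro: bounded_op_zero bounded_op_add)

lemma op_pos_add: "op_pos A \<Longrightarrow> op_pos B \<Longrightarrow> op_pos (\<lambda>x. A x + B x)"
  by (auto simp: op_pos_def bounded_op_add cinner_add_left)

lemma op_pos_zero: "op_pos (\<lambda>x. 0)"
  by (simp add: op_pos_def bounded_op_zero)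

lemma op_pos_sum:
  assumes "\<And>i. i \<in> I \<Longrightarrow> op_pos (A i)"
  shows "op_pos (\<lambda>x. \<Sum>i\<in>I. A i x)"
  using assms by (induction I rule: infinite_finite_induct) (auto intro: op_pos_zero op_pos_add)

lemma op_pos_scaleC:
  assumes "op_pos A" "0 \<le> c"
  shows "op_pos (\<lambda>x. scaleC (complex_of_real c) (A x))"
  using assms by (auto simp: op_pos_def bounded_op_scaleC cinner_scaleC_left)

lemma op_pos_diff_iff:
  assumes "op_pos A" "op_pos B"
  shows "op_pos (\<lambda>x. B x - A x) \<longleftrightarrow> (\<forall>x. qform A x \<le> qform B x)"
  using assms by (auto simp: op_pos_def bounded_op_diff cinner_diff_left qform_def)

lemma qform_add: "qform (\<lambda>x. A x + B x) x = qform A x + qform B x"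
  and qform_diff: "qform (\<lambda>x. A x - B x) x = qform A x - qform B x"
  and qform_scaleC: "qform (\<lambda>x. scaleC (complex_of_real c) (A x)) x = c * qform A x"
  and qform_sum: "qform (\<lambda>x. \<Sum>i\<in>I. C i x) x = (\<Sum>i\<in>I. qform (C i) x)"
  by (simp_all add: qform_def cinner_add_left cinner_diff_left cinner_scaleC_left cinner_sum_left)

text \<open>Cauchy-Schwarz with \<open>y = A x\<close>, after which one factor
  \<open>(norm (A x))\<^sup>2\<close> cancels. Small values of the form thus force small
  vectors.\<close>

lemma op_pos_norm_bound:
  assumes "op_pos A" "\<And>x. qform A x \<le> K * (norm x)\<^sup>2"
  shows "(norm (A x))\<^sup>2 \<le> K * qform A x"
proof (cases "A x = 0")
  case True
  then show ?thesis by (simp add: qform_def)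
next
  case False
  have "((norm (A x))\<^sup>2)\<^sup>2 \<le> qform A x * qform A (A x)"
    using op_pos_Cauchy_Schwarz [OF assms(1), of x "A x"]
    by (simp add: cinner_self_norm norm_power)
  also have "\<dots> \<le> qform A x * (K * (norm (A x))\<^sup>2)"
    by (intro mult_left_mono assms op_pos_qform_nonneg)
  finally have "(norm (A x))\<^sup>2 * (norm (A x))\<^sup>2 \<le> (K * qform A x) * (norm (A x))\<^sup>2"
    by (simp add: power2_eq_square mult_ac)
  then show ?thesis
    by (rule mult_right_le_imp_le) (simp add: False)
qed

lemma op_pos_qform_eq_0:
  assumes "op_pos A" "qform A x = 0"
  shows "A x = 0"
  using op_pos_Cauchy_Schwarz [OF assms(1), of x "A x"] assms(2)
  by (simp add: cinner_self_norm)

lemma bounded_op_qform_le: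
  assumes "bounded_op A"
  obtains K where "0 \<le> K" "\<And>x. qform A x \<le> K * (norm x)\<^sup>2"
proof -
  obtain K where K: "norm (A x) \<le> K * norm x" for x
    using assms by (auto simp: bounded_op_def)
  \<comment> \<open>The absolute value makes the constant nonnegative; on the zero space
    \<open>K\<close> itself may be negative.\<close>
  have "qform A x \<le> \<bar>K\<bar> * (norm x)\<^sup>2" for x
  proof -
    have "qform A x \<le> norm (A x) * norm x"
      unfolding qform_def using complex_Re_le_cmod cinner_Cauchy_Schwarz order_trans by blast
    also have "\<dots> \<le> (\<bar>K\<bar> * norm x) * norm x"
      by (intro mult_right_mono order_trans [OF K]) (auto intro: mult_right_mono)
    finally show ?thesis by (simp add: power2_eq_square mult.assoc)
  qed
  then show thesis using that [of "\<bar>K\<bar>"] by auto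
qed

section \<open>Monotone limits and uniform boundedness\<close>

lemma tendsto_qform: "(\<lambda>n. A n x) \<longlonglongrightarrow> a x \<Longrightarrow> (\<lambda>n. qform (A n) x) \<longlonglongrightarrow> qform a x"
  unfolding qform_def by (intro tendsto_Re tendsto_cinner tendsto_const)

lemma bounded_op_LIMSEQ:
  assumes "\<And>n. clinear_op (S n)" "\<And>x. (\<lambda>n. S n x) \<longlonglongrightarrow> y x"
    and "\<And>n x. norm (S n x) \<le> K * norm x"
  shows "bounded_op y"
  unfolding bounded_op_def clinear_op_def
proof (intro conjI allI exI)
  fix u v c
  have "(\<lambda>n. S n (u + v)) \<longlonglongrightarrow> y u + y v"
    using assms(1) by (simp add: clinear_op_add) (intro tendsto_add assms)
  then show "y (u + v) = y u + y v"
    using assms(2) LIMSEQ_unique by blast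
  have "(\<lambda>n. S n (scaleC c u)) \<longlonglongrightarrow> scaleC c (y u)"
    using assms(1) by (simp add: clinear_op_scaleC) (intro tendsto_scaleC assms)
  then show "y (scaleC c u) = scaleC c (y u)"
    using assms(2) LIMSEQ_unique by blast
  show "norm (y u) \<le> K * norm u"
    by (rule LIMSEQ_le_const2 [OF tendsto_norm [OF assms(2)]]) (use assms(3) in blast)
qed

text \<open>Vigier's theorem: the norms of the increments of a bounded increasing sequence are
  controlled by the increments of the quadratic form, by Cauchy-Schwarz.\<close>

lemma op_pos_incseq_LIMSEQ:
  assumes pos: "\<And>n. op_pos (S n)" and inc: "\<And>x. incseq (\<lambda>n. qform (S n) x)"
    and bnd: "\<And>n x. qform (S n) x \<le> K * (norm x)\<^sup>2"
  obtains y where "op_pos y" "\<And>x. (\<lambda>n. S n x) \<longlonglongrightarrow> y x"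
    "\<And>n x. qform (S n) x \<le> qform y x"
proof -
  define L where "L = \<bar>K\<bar>"
  have bnd': "qform (S n) x \<le> L * (norm x)\<^sup>2" for n x
    by (rule order_trans [OF bnd]) (auto simp: L_def intro: mult_right_mono)
  have step: "(norm (S n x - S m x))\<^sup>2 \<le> L * (qform (S n) x - qform (S m) x)" if "m \<le> n" for m n x
  proof -
    have "op_pos (\<lambda>x. S n x - S m x)"
      using pos inc that by (subst op_pos_diff_iff) (auto simp: incseq_def)
    moreover have "qform (\<lambda>x. S n x - S m x) z \<le> L * (norm z)\<^sup>2" for z
      using bnd' [of n z] op_pos_qform_nonneg [OF pos, of m z] by (simp add: qform_diff)
    ultimately show ?thesis
      using op_pos_norm_bound [of "\<lambda>x. S n x - S m x" L x] by (simp add: qform_diff)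
  qed
  have "Cauchy (\<lambda>n. S n x)" for x
  proof (rule metric_CauchyI)
    fix e :: real assume "0 < e"
    have "Bseq (\<lambda>n. qform (S n) x)"
      using bnd' op_pos_qform_nonneg [OF pos] by (intro BseqI' [of _ "L * (norm x)\<^sup>2"]) auto
    then have "Cauchy (\<lambda>n. qform (S n) x)"
      using Bseq_monoseq_convergent [of "\<lambda>n. qform (S n) x"] inc
      by (simp add: convergent_Cauchy incseq_imp_monoseq)
    \<comment> \<open>The \<open>+ 1\<close> keeps the divisor positive when \<open>L = 0\<close>.
      By \<open>step\<close>, form values this close give vectors closer than
      \<open>e\<close>.\<close>
    then obtain N where N: "dist (qform (S m) x) (qform (S n) x) < e\<^sup>2 / (L + 1)"
      if "m \<ge> N" "n \<ge> N" for m n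
      using metric_CauchyD [of "\<lambda>n. qform (S n) x" "e\<^sup>2 / (L + 1)"] \<open>0 < e\<close>
      by (auto simp: L_def)
    have 1: "norm (S n x - S m x) < e" if "m \<ge> N" "m \<le> n" for m n
    proof -
      have "0 \<le> qform (S n) x - qform (S m) x"
        using inc that by (auto simp: incseq_def)
      then have "(norm (S n x - S m x))\<^sup>2 \<le> (L + 1) * (qform (S n) x - qform (S m) x)"
        using step [OF that(2), of x] by (simp add: algebra_simps)
      also have "\<dots> < e\<^sup>2"
        using N [of n m] that by (simp add: dist_real_def L_def pos_less_divide_eq mult.commute
            abs_less_iff)
      finally show ?thesis
        by (rule power2_less_imp_less) (use \<open>0 < e\<close> in simp)
    qed
    show "\<exists>M. \<forall>m\<ge>M. \<forall>n\<ge>M. dist (S m x) (S n x) < e"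
    proof (intro exI allI impI)
      fix m n assume "m \<ge> N" "n \<ge> N"
      then show "dist (S m x) (S n x) < e"
        using 1 [of m n] 1 [of n m] by (cases m n rule: le_cases) (auto simp: dist_norm norm_minus_commute)
    qed
  qed
  then have lim: "(\<lambda>n. S n x) \<longlonglongrightarrow> lim (\<lambda>n. S n x)" for x
    by (simp add: Cauchy_convergent convergent_LIMSEQ_iff [symmetric])
  define y where "y x = lim (\<lambda>n. S n x)" for x
  note lim = lim [folded y_def]
  have "norm (S n x) \<le> L * norm x" for n x
  proof -
    have "(norm (S n x))\<^sup>2 \<le> L * (L * (norm x)\<^sup>2)"
      using order_trans [OF op_pos_norm_bound [OF pos bnd'] mult_left_mono [OF bnd', of L n x]]
      by (simp add: L_def)
    then have "(norm (S n x))\<^sup>2 \<le> (L * norm x)\<^sup>2"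
      by (simp add: power2_eq_square mult_ac)
    then show ?thesis
      by (rule power2_le_imp_le) (simp add: L_def)
  qed
  then have bdd: "bounded_op y"
    by (rule bounded_op_LIMSEQ [OF op_pos_clinear [OF pos] lim])
  have lims: "(\<lambda>n. qform (S n) x) \<longlonglongrightarrow> qform y x" for x
    by (intro tendsto_qform lim)
  have le: "qform (S n) x \<le> qform y x" for n x
    using incseq_le [OF inc lims] .
  have "Im (cinner (y x) x) = 0" for x
  proof -
    have "(\<lambda>n. Im (cinner (S n x) x)) \<longlonglongrightarrow> Im (cinner (y x) x)"
      by (intro tendsto_Im tendsto_cinner tendsto_const lim)
    moreover have "Im (cinner (S n x) x) = 0" for n
      by (simp add: op_pos_cinner_eq [OF pos])
    ultimately show ?thesis by (simp add: LIMSEQ_const_iff)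
  qed
  moreover have "0 \<le> qform y x" for x
    using le op_pos_qform_nonneg [OF pos] order_trans by blast
  ultimately have "op_pos y"
    by (simp add: op_pos_def bdd complex_is_Real_iff qform_def)
  then show thesis using that lim le by blast
qed

lemma qform_parallelogram:
  assumes "clinear_op A"
  shows "qform A (x + y) + qform A (x - y) = 2 * qform A x + 2 * qform A y"
  by (simp add: qform_def clinear_op_add [OF assms] clinear_op_diff [OF assms] cinner_add_left
      cinner_add_right cinner_diff_left cinner_diff_right)

lemma qform_scaleC_arg:
  assumes "clinear_op A"
  shows "qform A (scaleC c x) = (cmod c)\<^sup>2 * qform A x"
proof -
  have "cinner (A (scaleC c x)) (scaleC c x) = of_real ((cmod c)\<^sup>2) * cinner (A x) x"
    by (simp only: complex_norm_square)
      (simp add: clinear_op_scaleC [OF assms] cinner_scaleC_left cinner_scaleC_right)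
  then show ?thesis
    by (simp add: qform_def del: of_real_power)
qed

lemma continuous_on_qform:
  assumes "bounded_op A"
  shows "continuous_on S (qform A)"
  unfolding qform_def
  by (intro continuous_on_Re bounded_bilinear.continuous_on [OF bounded_bilinear_cinner]
      linear_continuous_on bounded_op_bounded_linear assms continuous_on_id)

text \<open>Uniform boundedness for positive operators, by Baire's theorem applied to the sublevel
  sets of the supremum of the quadratic forms.\<close>

lemma op_pos_uniform_bounded:
  assumes pos: "\<And>n::nat. op_pos (A n)" and bnd: "\<And>x. \<exists>M. \<forall>n. qform (A n) x \<le> M"
  obtains K where "\<And>n x. qform (A n) x \<le> K * (norm x)\<^sup>2"
proof -
  define E where "E k = {x. \<forall>n. qform (A n) x \<le> real k}" for k :: nat
  have closedE: "closed (E k)" for k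
  proof -
    have "E k = (\<Inter>n. {x. qform (A n) x \<le> real k})"
      by (auto simp: E_def)
    then show ?thesis
      by (auto intro!: closed_Collect_le continuous_on_qform op_pos_bounded pos)
  qed
  have un: "\<Union>(range E) = UNIV"
  proof -
    have "x \<in> \<Union>(range E)" for x
    proof -
      obtain M where "\<And>n. qform (A n) x \<le> M" using bnd by blast
      then have "x \<in> E (nat \<lceil>M\<rceil>)"
        by (auto simp: E_def intro: order_trans real_nat_ceiling_ge)
      then show ?thesis by blast
    qed
    then show ?thesis by blast
  qed
  have "\<exists>k. interior (E k) \<noteq> {}"
  proof (rule ccontr)
    assume "\<not> ?thesis"
    then have "euclidean interior_of \<Union>(range E) = {}"
      by (intro Baire_category_alt disjI1 completely_metrizable_space_euclidean)
        (auto simp: closedE)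
    then show False by (simp add: un)
  qed
  then obtain k z where "z \<in> interior (E k)" by blast
  then obtain r where "0 < r" and r: "cball z r \<subseteq> E k"
    by (meson mem_interior_cball)
  have zE: "z \<in> E k" using r \<open>0 < r\<close> by auto
  \<comment> \<open>Recentring: the parallelogram law at \<open>z + h\<close> and \<open>z\<close>
    bounds the form at their difference \<open>h\<close> by values taken inside the ball.\<close>
  have small: "qform (A n) h \<le> 4 * real k" if "norm h \<le> r" for n h
  proof -
    have "z + h \<in> E k"
      using r that by (auto simp: dist_norm)
    then have "qform (A n) (z + h) \<le> real k" "qform (A n) z \<le> real k"
      using zE by (auto simp: E_def)
    moreover have "qform (A n) h \<le> 2 * qform (A n) (z + h) + 2 * qform (A n) z"
      using qform_parallelogram [OF op_pos_clinear [OF pos], of n "z + h" z]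
        op_pos_qform_nonneg [OF pos, of n "z + h + z"] by simp
    ultimately show ?thesis by linarith
  qed
  have "qform (A n) x \<le> (4 * real k / r\<^sup>2) * (norm x)\<^sup>2" for n x
  proof (cases "x = 0")
    case True
    then show ?thesis by (simp add: qform_def)
  next
    case False
    define c where "c = r / norm x"
    have "norm (scaleC (complex_of_real c) x) \<le> r"
      using False \<open>0 < r\<close> by (simp add: norm_scaleC c_def norm_divide)
    then have "c\<^sup>2 * qform (A n) x \<le> 4 * real k"
      using small [of "scaleC (complex_of_real c) x" n]
      by (simp add: qform_scaleC_arg [OF op_pos_clinear [OF pos]])
    then show ?thesis
      using False \<open>0 < r\<close> by (simp add: c_def power_divide field_simps)
  qed
  then show thesis using that by blast
qed

section \<open>Subspaces, projections and orthonormal bases\<close>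

definition csubspace :: "'h::chilbert set \<Rightarrow> bool" where
  "csubspace W \<longleftrightarrow> 0 \<in> W \<and> (\<forall>x\<in>W. \<forall>y\<in>W. x + y \<in> W) \<and> (\<forall>c. \<forall>x\<in>W. scaleC c x \<in> W)"

lemma csubspace_0: "csubspace W \<Longrightarrow> 0 \<in> W"
  and csubspace_add: "csubspace W \<Longrightarrow> x \<in> W \<Longrightarrow> y \<in> W \<Longrightarrow> x + y \<in> W"
  and csubspace_scaleC: "csubspace W \<Longrightarrow> x \<in> W \<Longrightarrow> scaleC c x \<in> W"
  by (auto simp: csubspace_def)

lemma csubspace_diff: "csubspace W \<Longrightarrow> x \<in> W \<Longrightarrow> y \<in> W \<Longrightarrow> x - y \<in> W"
  using csubspace_add [of W x "scaleC (-1) y"] csubspace_scaleC [of W y "-1"]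
  by (simp add: scaleC_uminus_one)

lemma csubspace_sum: "csubspace W \<Longrightarrow> (\<And>i. i \<in> I \<Longrightarrow> f i \<in> W) \<Longrightarrow> sum f I \<in> W"
  by (induction I rule: infinite_finite_induct) (auto intro: csubspace_0 csubspace_add)

lemma csubspace_range:
  assumes "clinear_op A"
  shows "csubspace (range A)"
  unfolding csubspace_def
proof (intro conjI ballI allI)
  show "0 \<in> range A"
    using clinear_op_diff [OF assms, of 0 0] by (auto intro: range_eqI [of _ _ 0])
qed (auto simp: clinear_op_add [OF assms, symmetric] clinear_op_scaleC [OF assms, symmetric])

lemma csubspace_closure:
  assumes "csubspace W"
  shows "csubspace (closure W)"
  unfolding csubspace_def
proof (intro conjI ballI allI)
  show "0 \<in> closure W"
    using assms closure_subset csubspace_0 by blast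
next
  fix x y assume "x \<in> closure W" "y \<in> closure W"
  then obtain f g where "\<And>n. f n \<in> W" "f \<longlonglongrightarrow> x" "\<And>n. g n \<in> W" "g \<longlonglongrightarrow> y"
    by (metis closure_sequential)
  then show "x + y \<in> closure W"
    unfolding closure_sequential
    by (intro exI [of _ "\<lambda>n. f n + g n"]) (auto intro: tendsto_add csubspace_add assms)
next
  fix c x assume "x \<in> closure W"
  then obtain f where "\<And>n. f n \<in> W" "f \<longlonglongrightarrow> x"
    by (metis closure_sequential)
  then show "scaleC c x \<in> closure W"
    unfolding closure_sequential
    by (intro exI [of _ "\<lambda>n. scaleC c (f n)"]) (auto intro: tendsto_scaleC csubspace_scaleC assms)
qed

lemma cspan_superset: "S \<subseteq> cspan S"
proof
  fix x assume "x \<in> S"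
  then show "x \<in> cspan S"
    unfolding cspan_def
    by (intro CollectI exI [of _ "{x}"] exI [of _ "\<lambda>_. 1"]) (auto simp: scaleC_one)
qed

lemma csubspace_cspan: "csubspace (cspan S)"
  unfolding csubspace_def
proof (intro conjI ballI allI)
  show "0 \<in> cspan S"
    unfolding cspan_def by (intro CollectI exI [of _ "{}"]) auto
next
  fix x y assume "x \<in> cspan S" "y \<in> cspan S"
  then obtain F c G d where F: "finite F" "F \<subseteq> S" "x = (\<Sum>v\<in>F. scaleC (c v) v)"
    and G: "finite G" "G \<subseteq> S" "y = (\<Sum>v\<in>G. scaleC (d v) v)"
    unfolding cspan_def by blast
  \<comment> \<open>Padding the coefficients by zero writes both sums over the common index set
    \<open>F \<union> G\<close>.\<close>
  have "x = (\<Sum>v\<in>F \<union> G. scaleC (if v \<in> F then c v else 0) v)"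
    unfolding F(3) using F(1) G(1) by (intro sum.mono_neutral_cong_left) auto
  moreover have "y = (\<Sum>v\<in>F \<union> G. scaleC (if v \<in> G then d v else 0) v)"
    unfolding G(3) using F(1) G(1) by (intro sum.mono_neutral_cong_left) auto
  ultimately have "x + y = (\<Sum>v\<in>F \<union> G.
      scaleC ((if v \<in> F then c v else 0) + (if v \<in> G then d v else 0)) v)"
    by (simp only: scaleC_add_left sum.distrib)
  then show "x + y \<in> cspan S"
    unfolding cspan_def using F(1,2) G(1,2)
    by (intro CollectI exI [of _ "F \<union> G"] exI) auto
next
  fix k x assume "x \<in> cspan S"
  then obtain F c where F: "finite F" "F \<subseteq> S" "x = (\<Sum>v\<in>F. scaleC (c v) v)"
    unfolding cspan_def by blast
  have "scaleC k x = (\<Sum>v\<in>F. scaleC k (scaleC (c v) v))"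
    unfolding F(3) by (rule linear_sum [OF bounded_linear.linear [OF bounded_linear_scaleC]])
  also have "\<dots> = (\<Sum>v\<in>F. scaleC (k * c v) v)"
    by (simp add: scaleC_scaleC)
  finally show "scaleC k x \<in> cspan S"
    unfolding cspan_def using F(1,2) by (intro CollectI exI [of _ F] exI) auto
qed

lemma cspan_minimal:
  assumes "csubspace W" "S \<subseteq> W"
  shows "cspan S \<subseteq> W"
  unfolding cspan_def using assms by (auto intro!: csubspace_sum csubspace_scaleC)

lemma cspan_mono: "S \<subseteq> S' \<Longrightarrow> cspan S \<subseteq> cspan S'"
  by (meson cspan_minimal cspan_superset csubspace_cspan order_trans)

section \<open>Orthogonal decomposition along closed subspaces\<close>

lemma norm_parallelogram:
  "(norm (x + y))\<^sup>2 + (norm (x - y))\<^sup>2 = 2 * (norm (x::'h::chilbert))\<^sup>2 + 2 * (norm y)\<^sup>2"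
  using qform_parallelogram [OF op_pos_clinear [OF op_pos_id]] by (simp add: qform_id)

text \<open>\<open>m - m'\<close> lies in \<open>M\<close> and is orthogonal to \<open>M\<close>,
  hence to itself.\<close>

lemma orth_decomposition_unique:
  assumes "csubspace M" "m \<in> M" "m' \<in> M"
    and "\<And>w. w \<in> M \<Longrightarrow> cinner (x - m) w = 0" "\<And>w. w \<in> M \<Longrightarrow> cinner (x - m') w = 0"
  shows "m = m'"
proof -
  have M: "m - m' \<in> M" using assms by (simp add: csubspace_diff)
  have "cinner (m - m') (m - m') = cinner (x - m') (m - m') - cinner (x - m) (m - m')"
    by (simp add: cinner_diff_left)
  then show ?thesis using assms M by simp
qed

text \<open>Here \<open>m\<close> is the point of \<open>M\<close> nearest to \<open>x\<close>: a
  minimizing sequence is Cauchy by the parallelogram law, and a nonzero inner product with some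
  \<open>w\<close> would yield a closer point.\<close>

lemma orth_decomposition_exists:
  assumes M: "csubspace M" "closed M"
  obtains m where "m \<in> M" "\<And>w. w \<in> M \<Longrightarrow> cinner (x - m) w = 0"
proof -
  define d where "d = (INF m\<in>M. (norm (x - m))\<^sup>2)"
  have bb: "bdd_below ((\<lambda>m. (norm (x - m))\<^sup>2) ` M)"
    by (rule bdd_belowI [of _ 0]) auto
  have ne: "M \<noteq> {}" using M csubspace_0 by blast
  have d_le: "d \<le> (norm (x - m))\<^sup>2" if "m \<in> M" for m
    unfolding d_def by (rule cINF_lower [OF bb that])
  have "\<exists>m\<in>M. (norm (x - m))\<^sup>2 < d + 1 / real (Suc n)" for n
    using cINF_less_iff [OF ne bb, of "d + 1 / real (Suc n)"] by (simp add: d_def)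
  then obtain f where fM: "\<And>n. f n \<in> M"
    and f: "\<And>n. (norm (x - f n))\<^sup>2 < d + 1 / real (Suc n)"
    by metis
  have close: "(norm (f k - f l))\<^sup>2 \<le> 4 / real (Suc N)" if "N \<le> k" "N \<le> l" for k l N
  proof -
    \<comment> \<open>The midpoint stays in \<open>M\<close>, so its squared distance to
      \<open>x\<close> is at least \<open>d\<close>; in the parallelogram law the resulting
      \<open>4 * d\<close> cancels.\<close>
    define h where "h = scaleC (1/2) (f k + f l)"
    have "h \<in> M"
      unfolding h_def by (intro csubspace_scaleC csubspace_add M fM)
    have "scaleC 2 (x - h) = (x - f k) + (x - f l)"
    proof -
      have "scaleC 2 x = x + x"
        using scaleC_add_left [of 1 1 x] by (simp add: scaleC_one)
      then show ?thesis
        by (simp add: h_def scaleC_scaleC scaleC_one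
            linear_diff [OF bounded_linear.linear [OF bounded_linear_scaleC]])
    qed
    then have "norm ((x - f k) + (x - f l)) = 2 * norm (x - h)"
      by (metis norm_scaleC norm_numeral)
    then have "(norm ((x - f k) + (x - f l)))\<^sup>2 \<ge> 4 * d"
      using d_le [OF \<open>h \<in> M\<close>] by (simp add: power_mult_distrib)
    moreover have "norm ((x - f k) - (x - f l)) = norm (f k - f l)"
      by (simp add: norm_minus_commute)
    ultimately have "(norm (f k - f l))\<^sup>2 \<le> 2 / real (Suc k) + 2 / real (Suc l)"
      using norm_parallelogram [of "x - f k" "x - f l"] f [of k] f [of l] by simp
    also have "\<dots> \<le> 2 / real (Suc N) + 2 / real (Suc N)"
      using that by (intro add_mono divide_left_mono) auto
    finally show ?thesis by simp
  qed
  have "Cauchy f"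
  proof (rule metric_CauchyI)
    fix e :: real assume "0 < e"
    then obtain N where N: "4 / e\<^sup>2 < real (Suc N)"
      by (meson less_Suc_eq_le reals_Archimedean2 less_trans of_nat_less_iff lessI)
    have "dist (f k) (f l) < e" if "N \<le> k" "N \<le> l" for k l
    proof -
      have "(norm (f k - f l))\<^sup>2 \<le> 4 / real (Suc N)" by (rule close [OF that])
      also have "\<dots> < e\<^sup>2"
        using N \<open>0 < e\<close> by (simp add: field_simps)
      finally show ?thesis
        unfolding dist_norm by (rule power2_less_imp_less) (use \<open>0 < e\<close> in simp)
    qed
    then show "\<exists>N. \<forall>k\<ge>N. \<forall>l\<ge>N. dist (f k) (f l) < e" by blast
  qed
  then obtain m where lim: "f \<longlonglongrightarrow> m"
    by (auto simp: Cauchy_convergent_iff convergent_def)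
  have mM: "m \<in> M"
    using closed_sequentially [OF M(2) _ lim] fM by blast
  have "(norm (x - m))\<^sup>2 \<le> d + 0"
  proof (rule LIMSEQ_le)
    show "(\<lambda>n. (norm (x - f n))\<^sup>2) \<longlonglongrightarrow> (norm (x - m))\<^sup>2"
      by (intro tendsto_intros lim)
    show "(\<lambda>n. d + 1 / real (Suc n)) \<longlonglongrightarrow> d + 0"
      by (intro tendsto_intros LIMSEQ_Suc lim_1_over_n)
  qed (use f less_imp_le in blast)
  then have min: "(norm (x - m))\<^sup>2 \<le> (norm (x - m'))\<^sup>2" if "m' \<in> M" for m'
    using order_trans [OF _ d_le [OF that]] by simp
  have "cinner (x - m) w = 0" if "w \<in> M" for w
  proof (rule ccontr)
    assume nz: "cinner (x - m) w \<noteq> 0"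
    define b where "b = cinner (x - m) w"
    have w0: "w \<noteq> 0" using nz by auto
    \<comment> \<open>This \<open>t\<close> minimizes the quadratic along \<open>w\<close>; moving
      \<open>m\<close> by \<open>v\<close> lowers the squared distance by
      \<open>(cmod b)\<^sup>2 / (norm w)\<^sup>2\<close>.\<close>
    define t where "t = 1 / (norm w)\<^sup>2"
    define v where "v = scaleC (of_real t * b) w"
    have "(norm (x - m - v))\<^sup>2 = (norm (x - m))\<^sup>2 - (cmod b)\<^sup>2 / (norm w)\<^sup>2"
    proof -
      have "(norm (x - m - v))\<^sup>2
          = (norm (x - m))\<^sup>2 - 2 * t * (cmod b)\<^sup>2 + t\<^sup>2 * (cmod b)\<^sup>2 * (norm w)\<^sup>2"
        using qform_diff_scaleC [OF op_pos_id, of "x - m" t w] unfolding qform_id v_def b_def .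
      then show ?thesis
        using w0 by (simp add: t_def power2_eq_square)
    qed
    moreover have "m + v \<in> M"
      unfolding v_def by (intro csubspace_add csubspace_scaleC M mM that)
    moreover have "0 < (cmod b)\<^sup>2 / (norm w)\<^sup>2"
      using nz w0 by (simp add: b_def)
    ultimately show False
      using min [of "m + v"] by (simp add: diff_diff_eq)
  qed
  then show thesis using that mM by blast
qed

lemma orth_proj_orth:
  assumes "is_orth_proj p" "w \<in> range p"
  shows "cinner (x - p x) w = 0"
proof -
  obtain z where z: "w = p z" using assms(2) by blast
  have "p (p x) = p x" for x
    using assms(1) by (auto simp: is_orth_proj_def fun_eq_iff)
  then show ?thesis
    using assms(1) unfolding z is_orth_proj_def by (metis cinner_diff_left right_minus_eq)
qed

lemma orth_proj_unique:
  assumes "is_orth_proj p" "is_orth_proj p'" "range p = range p'"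
  shows "p = p'"
proof
  fix x
  have "csubspace (range p)"
    using assms(1) by (simp add: is_orth_proj_def bounded_op_clinear csubspace_range)
  then show "p x = p' x"
    using orth_proj_orth assms by (intro orth_decomposition_unique [of "range p" _ _ x]) auto
qed

text \<open>The component in \<open>M\<close> is chosen pointwise; uniqueness of the decomposition
  makes the choice linear.\<close>

lemma orth_proj_exists:
  assumes M: "csubspace M" "closed M"
  obtains p where "is_orth_proj p" "range p = M"
proof -
  have "\<forall>x. \<exists>m. m \<in> M \<and> (\<forall>w\<in>M. cinner (x - m) w = 0)"
    using orth_decomposition_exists [OF M] by metis
  then obtain p where pM: "\<And>x. p x \<in> M" and orth: "\<And>x w. w \<in> M \<Longrightarrow> cinner (x - p x) w = 0"
    by metis
  have unique: "p x = m" if "m \<in> M" "\<And>w. w \<in> M \<Longrightarrow> cinner (x - m) w = 0" for x m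
    using orth_decomposition_unique [OF M(1) pM that(1) orth that(2)] by blast
  have add: "p (x + y) = p x + p y" for x y
  proof (rule unique)
    fix w assume "w \<in> M"
    then have "cinner ((x - p x) + (y - p y)) w = 0"
      using orth by (simp only: cinner_add_left) simp
    then show "cinner (x + y - (p x + p y)) w = 0" by (simp add: algebra_simps)
  qed (use M pM in \<open>simp add: csubspace_add\<close>)
  have scale: "p (scaleC c x) = scaleC c (p x)" for c x
  proof (rule unique)
    fix w assume "w \<in> M"
    then show "cinner (scaleC c x - scaleC c (p x)) w = 0"
      using orth [of w x] by (simp add: cinner_diff_left cinner_scaleC_left)
  qed (use M pM in \<open>simp add: csubspace_scaleC\<close>)
  have id: "p x = x" if "x \<in> M" for x
    using that by (intro unique) auto
  have pe: "cinner (p x) w = cinner x w" if "w \<in> M" for x w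
    using orth [OF that, of x] by (simp add: cinner_diff_left)
  have sa: "cinner (p x) y = cinner x (p y)" for x y
    using pe [OF pM, of x y] pe [OF pM, of y x] by (metis cinner_commute)
  have "norm (p x) \<le> 1 * norm x" for x
  proof -
    have "norm (p x) * norm (p x) = cmod (cinner (p x) (p x))"
      by (simp add: cinner_self_norm norm_power power2_eq_square norm_mult)
    also have "\<dots> = cmod (cinner x (p x))"
      using pe [OF pM, of x x] by simp
    also have "\<dots> \<le> norm x * norm (p x)"
      by (rule cinner_Cauchy_Schwarz)
    finally show ?thesis
      by (cases "p x = 0") simp_all
  qed
  then have "bounded_op p"
    unfolding bounded_op_def clinear_op_def using add scale by blast
  then have "is_orth_proj p"
    using sa id pM by (auto simp: is_orth_proj_def fun_eq_iff)
  moreover have "range p = M"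
    using pM id by (metis image_subset_iff rangeI subsetI subset_antisym)
  ultimately show thesis using that by blast
qed

text \<open>Existence and uniqueness of the projection give the definite description in
  \<open>supp\<close> its meaning; afterwards only ranges have to be compared.\<close>

lemma supp_eq_iff:
  assumes "bounded_op y" "is_orth_proj q"
  shows "q = supp y \<longleftrightarrow> range q = closure (range y)"
proof -
  obtain p where p: "is_orth_proj p" "range p = closure (range y)"
    using orth_proj_exists [OF csubspace_closure [OF csubspace_range
          [OF bounded_op_clinear [OF assms(1)]]] closed_closure] .
  then have "supp y = p"
    unfolding supp_def by (intro the_equality) (auto intro!: orth_proj_unique [of _ p])
  then show ?thesis
    using p assms(2) orth_proj_unique by metis
qed

section \<open>Gram-Schmidt orthonormalization and countability of orthonormal sets\<close>

definition orthonormal :: "'h::chilbert set \<Rightarrow> bool" where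
  "orthonormal B \<longleftrightarrow> (\<forall>x\<in>B. norm x = 1) \<and> (\<forall>x\<in>B. \<forall>y\<in>B. x \<noteq> y \<longrightarrow> cinner x y = 0)"

text \<open>The stages are cumulative sets and a zero residual adds nothing, so \<open>d\<close> may
  repeat vectors or be linearly dependent.\<close>

primrec gram_schmidt :: "(nat \<Rightarrow> 'h::chilbert) \<Rightarrow> nat \<Rightarrow> 'h set" where
  "gram_schmidt d 0 = {}"
| "gram_schmidt d (Suc n) =
    (let r = d n - (\<Sum>b\<in>gram_schmidt d n. scaleC (cinner (d n) b) b)
     in if r = 0 then gram_schmidt d n
        else insert (scaleC (of_real (1 / norm r)) r) (gram_schmidt d n))"

lemma gram_schmidt_mono: "gram_schmidt d n \<subseteq> gram_schmidt d (Suc n)"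
  by (auto simp: Let_def)

lemma gram_schmidt_orthonormal:
  "finite (gram_schmidt d n) \<and> orthonormal (gram_schmidt d n)
    \<and> gram_schmidt d n \<subseteq> cspan (range d)"
proof (induction n)
  case 0
  then show ?case by (simp add: orthonormal_def)
next
  case (Suc n)
  define G where "G = gram_schmidt d n"
  define r where "r = d n - (\<Sum>b\<in>G. scaleC (cinner (d n) b) b)"
  note IH = Suc.IH [folded G_def]
  show ?case
  proof (cases "r = 0")
    case True
    then show ?thesis using IH by (simp add: Let_def r_def G_def)
  next
    case False
    define u where "u = scaleC (of_real (1 / norm r)) r"
    have eq: "gram_schmidt d (Suc n) = insert u G"
      using False by (simp add: Let_def r_def G_def u_def)
    have orth: "cinner r b = 0" if "b \<in> G" for b
    proof -
      have "(\<Sum>a\<in>G. cinner (d n) a * cinner a b) = (\<Sum>a\<in>G. if a = b then cinner (d n) b else 0)"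
        using IH that by (intro sum.cong) (auto simp: orthonormal_def cinner_self_norm)
      also have "\<dots> = cinner (d n) b"
        using IH that by simp
      finally show ?thesis
        by (simp add: r_def cinner_diff_left cinner_sum_left cinner_scaleC_left)
    qed
    have ub: "cinner u b = 0" "cinner b u = 0" if "b \<in> G" for b
      using orth [OF that] cinner_commute [of b r]
      by (simp_all add: u_def cinner_scaleC_left cinner_scaleC_right)
    have "norm u = 1"
      using False by (simp add: u_def norm_scaleC norm_divide)
    then have "orthonormal (insert u G)"
      using IH ub by (auto simp: orthonormal_def)
    moreover have "u \<in> cspan (range d)"
      unfolding u_def r_def using IH cspan_superset [of "range d"]
      by (intro csubspace_scaleC csubspace_diff csubspace_sum csubspace_cspan) auto
    ultimately show ?thesis
      unfolding eq using IH by simp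
  qed
qed

text \<open>\<open>d n\<close> is its residual plus a combination of earlier vectors, and the
  residual is zero or a multiple of the newly added vector.\<close>

lemma gram_schmidt_spans: "d n \<in> cspan (gram_schmidt d (Suc n))"
proof -
  define G where "G = gram_schmidt d n"
  define r where "r = d n - (\<Sum>b\<in>G. scaleC (cinner (d n) b) b)"
  have "r \<in> cspan (gram_schmidt d (Suc n))"
  proof (cases "r = 0")
    case True
    then show ?thesis by (simp add: csubspace_0 csubspace_cspan)
  next
    case False
    define u where "u = scaleC (of_real (1 / norm r)) r"
    have "u \<in> cspan (gram_schmidt d (Suc n))"
      using False cspan_superset [of "gram_schmidt d (Suc n)"]
      by (auto simp: Let_def r_def G_def u_def)
    moreover have "r = scaleC (of_real (norm r)) u"
      using False by (simp add: u_def scaleC_scaleC scaleC_one)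
    ultimately show ?thesis
      by (metis csubspace_scaleC csubspace_cspan)
  qed
  moreover have "(\<Sum>b\<in>G. scaleC (cinner (d n) b) b) \<in> cspan (gram_schmidt d (Suc n))"
    using gram_schmidt_mono [of d n] cspan_superset [of "gram_schmidt d (Suc n)"]
    by (intro csubspace_sum csubspace_scaleC csubspace_cspan) (auto simp: G_def)
  ultimately have "r + (\<Sum>b\<in>G. scaleC (cinner (d n) b) b) \<in> cspan (gram_schmidt d (Suc n))"
    by (intro csubspace_add csubspace_cspan)
  then show ?thesis by (simp add: r_def)
qed

text \<open>The algebraic spans agree, not only their closures: \<open>B\<close> therefore lies in
  every subspace that contains \<open>D\<close>, closed or not.\<close>

lemma orthonormal_spanning_exists:
  assumes "countable D"
  obtains B where "orthonormal B" "cspan B = cspan D"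
proof (cases "D = {}")
  case True
  then show thesis using that [of "{}"] by (simp add: orthonormal_def)
next
  case False
  define d where "d = from_nat_into D"
  have rd: "range d = D" using False assms by (simp add: d_def)
  define B where "B = (\<Union>n. gram_schmidt d n)"
  have mono: "gram_schmidt d m \<subseteq> gram_schmidt d n" if "m \<le> n" for m n
    using gram_schmidt_mono that by (rule lift_Suc_mono_le)
  have "orthonormal B"
    unfolding orthonormal_def
  proof (intro conjI ballI impI)
    show "norm x = 1" if "x \<in> B" for x
      using that gram_schmidt_orthonormal unfolding B_def orthonormal_def by blast
    fix x y assume "x \<in> B" "y \<in> B" "x \<noteq> y"
    then obtain m n where "x \<in> gram_schmidt d m" "y \<in> gram_schmidt d n"
      by (auto simp: B_def)
    then have "x \<in> gram_schmidt d (max m n)" "y \<in> gram_schmidt d (max m n)"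
      using mono by (meson max.cobounded1 max.cobounded2 subsetD)+
    then show "cinner x y = 0"
      using gram_schmidt_orthonormal \<open>x \<noteq> y\<close> unfolding orthonormal_def by blast
  qed
  moreover have "cspan B = cspan D"
  proof
    have "B \<subseteq> cspan D"
      using gram_schmidt_orthonormal [of d] by (auto simp: B_def rd)
    then show "cspan B \<subseteq> cspan D"
      by (intro cspan_minimal csubspace_cspan)
    have "d n \<in> cspan B" for n
      using gram_schmidt_spans [of d n] cspan_mono [of "gram_schmidt d (Suc n)" B]
      by (auto simp: B_def simp del: gram_schmidt.simps)
    then have "D \<subseteq> cspan B" unfolding rd [symmetric] by blast
    then show "cspan D \<subseteq> cspan B"
      by (intro cspan_minimal csubspace_cspan)
  qed
  ultimately show thesis by (rule that)
qed

text \<open>Distinct orthonormal vectors are at distance \<open>sqrt 2\<close>, so choosing for each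
  a point of a countable set within \<open>1/2\<close> is injective.\<close>

lemma orthonormal_countable:
  assumes "orthonormal B" "B \<subseteq> M" "separable_set M"
  shows "countable B"
proof -
  obtain D where D: "countable D" "M \<subseteq> closure D"
    using assms(3) by (auto simp: separable_set_def)
  have "\<exists>d\<in>D. dist d x < 1/2" if "x \<in> B" for x
  proof -
    have "x \<in> closure D" using that assms(2) D(2) by blast
    moreover have "(0::real) < 1/2" by simp
    ultimately show ?thesis unfolding closure_approachable by blast
  qed
  then obtain f where f: "\<And>x. x \<in> B \<Longrightarrow> f x \<in> D" "\<And>x. x \<in> B \<Longrightarrow> dist (f x) x < 1/2"
    by metis
  have "inj_on f B"
  proof (rule inj_onI, rule ccontr)
    fix x y assume xy: "x \<in> B" "y \<in> B" "f x = f y" "x \<noteq> y"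
    have "dist x y < 1"
      using dist_triangle [of x y "f x"] f(2) [OF xy(1)] f(2) [OF xy(2)] xy(3)
      by (simp add: dist_commute)
    then have "(norm (x - y))\<^sup>2 < 1"
      by (simp add: dist_norm abs_square_less_1)
    moreover have "(norm (x - y))\<^sup>2 = 2"
    proof -
      have "cinner x x = 1" "cinner y y = 1" "cinner x y = 0" "cinner y x = 0"
        using assms(1) xy by (auto simp: orthonormal_def cinner_self_norm)
      then show ?thesis
        unfolding Re_cinner_self [symmetric] by (simp add: cinner_diff_left cinner_diff_right)
    qed
    ultimately show False by simp
  qed
  then show ?thesis
    using D(1) f(1) by (meson countable_image_inj_on countable_subset image_subsetI)
qed

section \<open>Projections as positive operators and compression to their range\<close>

lemma orth_proj_idem: "is_orth_proj p \<Longrightarrow> p (p x) = p x"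
  by (auto simp: is_orth_proj_def fun_eq_iff)

lemma orth_proj_range_iff: "is_orth_proj p \<Longrightarrow> x \<in> range p \<longleftrightarrow> p x = x"
  by (metis orth_proj_idem rangeE rangeI)

lemma orth_proj_selfadjoint: "is_orth_proj p \<Longrightarrow> cinner (p x) y = cinner x (p y)"
  by (simp add: is_orth_proj_def)

lemma orth_proj_clinear: "is_orth_proj p \<Longrightarrow> clinear_op p"
  by (simp add: is_orth_proj_def bounded_op_def)

lemma orth_proj_cinner:
  assumes "is_orth_proj p"
  shows "cinner (p x) x = of_real ((norm (p x))\<^sup>2)"
  using orth_proj_selfadjoint [OF assms, of "p x" x]
  unfolding orth_proj_idem [OF assms] cinner_self_norm .

lemma orth_proj_qform: "is_orth_proj p \<Longrightarrow> qform p x = (norm (p x))\<^sup>2"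
  by (simp add: qform_def orth_proj_cinner)

lemma orth_proj_pos:
  assumes "is_orth_proj p"
  shows "op_pos p"
  using assms by (simp add: op_pos_def orth_proj_cinner [OF assms] is_orth_proj_def)

lemma orth_proj_qform_le:
  assumes "is_orth_proj p"
  shows "qform p x \<le> (norm x)\<^sup>2"
proof -
  have "(norm (p x))\<^sup>2 \<le> norm (p x) * norm x"
    using cinner_Cauchy_Schwarz [of "p x" x] by (simp add: orth_proj_cinner [OF assms] norm_power)
  then have "norm (p x) \<le> norm x"
    by (cases "p x = 0") (simp_all add: power2_eq_square)
  then show ?thesis
    by (simp add: orth_proj_qform [OF assms] power_mono)
qed

lemma orth_proj_closed_range:
  assumes "is_orth_proj p"
  shows "closed (range p)"
proof -
  have "range p = {x. p x = x}"
    using orth_proj_range_iff [OF assms] by blast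
  moreover have "continuous_on UNIV p"
    using assms by (intro linear_continuous_on bounded_op_bounded_linear) (simp add: is_orth_proj_def)
  ultimately show ?thesis
    by (simp add: closed_Collect_eq continuous_on_id)
qed

text \<open>\<open>x - q x\<close> lies in the kernel of \<open>q\<close>, which gives the first
  identity; the second is its adjoint.\<close>

lemma op_pos_compress:
  assumes "op_pos A" "is_orth_proj q" and ker: "\<And>v. q v = 0 \<Longrightarrow> A v = 0"
  shows "A (q x) = A x" and "q (A x) = A x"
proof -
  have 1: "A (q x) = A x" for x
  proof -
    have "q (x - q x) = 0"
      using assms(2) by (simp add: clinear_op_diff orth_proj_clinear orth_proj_idem)
    from ker [OF this] show ?thesis
      by (simp add: clinear_op_diff [OF op_pos_clinear [OF assms(1)]])
  qed
  show "A (q x) = A x" by (rule 1)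
  show "q (A x) = A x"
  proof (rule cinner_eqI)
    fix w
    have "cinner (q (A x)) w = cinner x (A (q w))"
      by (simp add: orth_proj_selfadjoint [OF assms(2)] op_pos_selfadjoint [OF assms(1)])
    then show "cinner (q (A x)) w = cinner (A x) w"
      by (simp add: 1 op_pos_selfadjoint [OF assms(1)])
  qed
qed

text \<open>The form of \<open>A\<close> at \<open>v\<close> is squeezed to zero, and a positive
  operator kills every zero of its form.\<close>

lemma op_pos_kernel_mono:
  assumes "op_pos A" "B v = 0" "qform A v \<le> c * qform B v"
  shows "A v = 0"
  using assms op_pos_qform_nonneg [OF assms(1), of v]
  by (intro op_pos_qform_eq_0) (auto simp: qform_def)

section \<open>Orthonormal bases and rank one operators\<close>

lemma is_onb_orthonormal:
  "is_onb B M \<longleftrightarrow> B \<subseteq> M \<and> orthonormal B \<and> closure (cspan B) = M"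
  by (auto simp: is_onb_def orthonormal_def)

text \<open>The vectors orthogonal to \<open>v\<close> form a closed subspace containing
  \<open>B\<close>, hence containing \<open>M\<close>, so \<open>v\<close> is orthogonal to
  itself.\<close>

lemma is_onb_orthogonal_eq_0:
  assumes "is_onb B M" "v \<in> M" "\<And>b. b \<in> B \<Longrightarrow> cinner v b = 0"
  shows "v = 0"
proof -
  have "csubspace {w. cinner v w = 0}"
    by (auto simp: csubspace_def cinner_add_right cinner_scaleC_right)
  then have "cspan B \<subseteq> {w. cinner v w = 0}"
    using assms(3) by (intro cspan_minimal) auto
  moreover have "closed {w. cinner v w = 0}"
    by (intro closed_Collect_eq continuous_on_const continuous_on_id
        bounded_bilinear.continuous_on [OF bounded_bilinear_cinner])
  ultimately have "closure (cspan B) \<subseteq> {w. cinner v w = 0}"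
    by (rule closure_minimal)
  then have "cinner v v = 0"
    using assms(1,2) by (auto simp: is_onb_def)
  then show ?thesis by simp
qed

lemma t_vec_cinner: "cinner (t_vec \<xi> x) x = of_real ((cmod (cinner x \<xi>))\<^sup>2)"
  unfolding t_vec_def cinner_scaleC_left complex_norm_square by (metis cinner_commute)

lemma t_vec_qform: "qform (t_vec \<xi>) x = (cmod (cinner x \<xi>))\<^sup>2"
  unfolding qform_def t_vec_cinner by (simp only: Re_complex_of_real)

lemma t_vec_pos: "op_pos (t_vec \<xi>)"
proof -
  have "norm (t_vec \<xi> x) \<le> (norm \<xi>)\<^sup>2 * norm x" for x
    using mult_right_mono [OF cinner_Cauchy_Schwarz [of x \<xi>], of "norm \<xi>"]
    by (simp add: t_vec_def norm_scaleC power2_eq_square mult_ac)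
  then have "\<exists>K. \<forall>x. norm (t_vec \<xi> x) \<le> K * norm x" by blast
  then have "bounded_op (t_vec \<xi>)"
    by (auto simp: bounded_op_def clinear_op_def t_vec_def cinner_add_left cinner_scaleC_left
        scaleC_add_left scaleC_scaleC)
  then show ?thesis
    by (simp add: op_pos_def t_vec_cinner del: of_real_power)
qed

text \<open>\<open>q\<close> fixes \<xi>, so \<open>x\<close> may be replaced by \<open>q x\<close>
  before Cauchy-Schwarz is applied.\<close>

lemma t_vec_le_orth_proj:
  assumes "is_orth_proj q" "\<xi> \<in> range q" "norm \<xi> \<le> 1"
  shows "qform (t_vec \<xi>) x \<le> qform q x"
proof -
  have "cinner x \<xi> = cinner (q x) \<xi>"
    using assms by (metis orth_proj_range_iff orth_proj_selfadjoint)
  then have "cmod (cinner x \<xi>) \<le> norm (q x) * norm \<xi>"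
    using cinner_Cauchy_Schwarz by simp
  also have "\<dots> \<le> norm (q x)"
    using assms(3) by (simp add: mult_left_le)
  finally show ?thesis
    by (simp add: t_vec_qform orth_proj_qform [OF assms(1)] power_mono)
qed

section \<open>Summability\<close>

locale markov =
  fixes T :: "('h::chilbert \<Rightarrow> 'h) \<Rightarrow> ('h \<Rightarrow> 'h)"
  assumes markov: "markov_op T"
begin

lemma T_linear: "op_map_linear T"
  using markov by (simp add: markov_op_def)

text \<open>Complete positivity applied to 1 by 1 blocks.\<close>

lemma T_pos:
  assumes "op_pos A"
  shows "op_pos (T A)"
proof -
  have "block_pos 1 (\<lambda>i j. A)"
    using assms by (simp add: block_pos_def op_pos_def)
  then have "block_pos 1 (\<lambda>i j. T A)"
    using markov op_pos_bounded [OF assms]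
    unfolding markov_op_def completely_positive_def
    by (elim conjE allE [of _ 1] allE [of _ "\<lambda>i j. A"]) simp
  then have "cinner (T A x) x \<in> \<real> \<and> 0 \<le> Re (cinner (T A x) x)" for x
    unfolding block_pos_def by (elim allE [of _ "\<lambda>_. x"]) simp
  moreover have "bounded_op (T A)"
    using T_linear op_pos_bounded [OF assms] by (simp add: op_map_linear_def)
  ultimately show ?thesis by (simp add: op_pos_def)
qed

lemma iter_bounded: "bounded_op A \<Longrightarrow> bounded_op ((T ^^ n) A)"
  using T_linear by (induction n) (auto simp: op_map_linear_def)

lemma iter_pos: "op_pos A \<Longrightarrow> op_pos ((T ^^ n) A)"
  by (induction n) (auto simp: T_pos)

lemma iter_add:
  "bounded_op A \<Longrightarrow> bounded_op B \<Longrightarrow>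
    (T ^^ n) (\<lambda>x. A x + B x) = (\<lambda>x. (T ^^ n) A x + (T ^^ n) B x)"
  using T_linear by (induction n) (auto simp: op_map_linear_def iter_bounded)

lemma iter_scaleC:
  "bounded_op A \<Longrightarrow> (T ^^ n) (\<lambda>x. scaleC c (A x)) = (\<lambda>x. scaleC c ((T ^^ n) A x))"
  using T_linear by (induction n) (auto simp: op_map_linear_def iter_bounded)

lemma iter_diff:
  assumes "bounded_op A" "bounded_op B"
  shows "(T ^^ n) (\<lambda>x. A x - B x) = (\<lambda>x. (T ^^ n) A x - (T ^^ n) B x)"
  using iter_add [OF assms(1) bounded_op_scaleC [OF assms(2), of "-1"], of n]
    iter_scaleC [OF assms(2), of n "-1"]
  by (simp add: scaleC_uminus_one)

lemma iter_zero: "(T ^^ n) (\<lambda>x. 0) = (\<lambda>x. 0)"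
  using iter_scaleC [OF bounded_op_zero, of n 0] by simp

lemma iter_sum:
  assumes "\<And>i. i \<in> I \<Longrightarrow> bounded_op (A i)"
  shows "(T ^^ n) (\<lambda>x. \<Sum>i\<in>I. A i x) = (\<lambda>x. \<Sum>i\<in>I. (T ^^ n) (A i) x)"
  using assms
  by (induction I rule: infinite_finite_induct) (simp_all add: iter_zero iter_add bounded_op_sum)

text \<open>The iterates are positive on the difference of \<open>c\<close> times \<open>B\<close>
  and \<open>A\<close>. Order is stated through forms with an explicit constant, as the domination
  arguments require.\<close>

lemma iter_mono:
  assumes "op_pos A" "op_pos B" "0 \<le> c" and le: "\<And>x. qform A x \<le> c * qform B x"
  shows "qform ((T ^^ n) A) x \<le> c * qform ((T ^^ n) B) x"
proof -
  let ?cB = "\<lambda>x. scaleC (of_real c) (B x)"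
  have cB: "op_pos ?cB"
    using assms by (intro op_pos_scaleC)
  then have "op_pos (\<lambda>x. ?cB x - A x)"
    using assms by (subst op_pos_diff_iff) (auto simp: qform_scaleC)
  then have "0 \<le> qform ((T ^^ n) (\<lambda>x. ?cB x - A x)) x"
    by (intro op_pos_qform_nonneg iter_pos)
  then show ?thesis
    by (simp add: iter_diff op_pos_bounded assms cB iter_scaleC qform_diff qform_scaleC)
qed

section \<open>Potentials and criteria for summability\<close>

lemma iter_qform_sums:
  assumes "\<And>x. (\<lambda>n. (T ^^ n) A x) sums y x"
  shows "(\<lambda>n. qform ((T ^^ n) A) x) sums qform y x"
  using tendsto_qform [of "\<lambda>N x. \<Sum>n<N. (T ^^ n) A x" x y] assms
  by (simp add: sums_def qform_sum)

lemma iter_qform_sum_le: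
  assumes "op_pos A" "\<And>x. (\<lambda>n. (T ^^ n) A x) sums y x" "finite I"
  shows "(\<Sum>n\<in>I. qform ((T ^^ n) A) x) \<le> qform y x"
proof -
  have "(\<Sum>n\<in>I. qform ((T ^^ n) A) x) \<le> (\<Sum>n. qform ((T ^^ n) A) x)"
    using iter_qform_sums [OF assms(2), of x] assms(3)
    by (intro sum_le_suminf) (auto simp: sums_iff intro: op_pos_qform_nonneg iter_pos assms(1))
  then show ?thesis
    using iter_qform_sums [OF assms(2), of x] by (simp add: sums_iff)
qed

text \<open>The partial sums form an increasing sequence of positive operators, so
  \<open>op_pos_incseq_LIMSEQ\<close> turns the bound on forms into strong convergence.\<close>

lemma potential_of_bounded:
  assumes "op_pos A" and bnd: "\<And>N x. (\<Sum>n<N. qform ((T ^^ n) A) x) \<le> K * (norm x)\<^sup>2"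
  obtains y where "op_pos y" "\<And>x. (\<lambda>n. (T ^^ n) A x) sums y x"
proof -
  let ?S = "\<lambda>N x. \<Sum>n<N. (T ^^ n) A x"
  have "\<And>N. op_pos (?S N)"
    by (intro op_pos_sum iter_pos assms)
  moreover have "\<And>x. incseq (\<lambda>N. qform (?S N) x)"
    unfolding qform_sum by (intro incseq_SucI) (simp add: op_pos_qform_nonneg iter_pos assms)
  moreover have "\<And>N x. qform (?S N) x \<le> K * (norm x)\<^sup>2"
    using bnd by (simp add: qform_sum)
  ultimately obtain y where "op_pos y" "\<And>x. (\<lambda>N. ?S N x) \<longlonglongrightarrow> y x"
    by (rule op_pos_incseq_LIMSEQ) blast
  then show thesis
    using that by (simp add: sums_def)
qed

lemma T_summable_pos: "T_summable T A \<Longrightarrow> op_pos A"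
  by (simp add: T_summable_def)

text \<open>Together with \<open>T_summableI\<close> this trades strong convergence for a uniform
  bound on forms, which passes to sums and to dominated operators.\<close>

lemma T_summable_bounded:
  assumes "T_summable T A"
  shows "\<exists>K\<ge>0. \<forall>N x. (\<Sum>n<N. qform ((T ^^ n) A) x) \<le> K * (norm x)\<^sup>2"
proof -
  obtain y where y: "bounded_op y" "\<And>x. (\<lambda>n. (T ^^ n) A x) sums y x"
    using assms by (auto simp: T_summable_def)
  obtain K where K: "0 \<le> K" "\<And>x. qform y x \<le> K * (norm x)\<^sup>2"
    using bounded_op_qform_le [OF y(1)] by blast
  have "op_pos A" by (rule T_summable_pos [OF assms])
  then have "(\<Sum>n<N. qform ((T ^^ n) A) x) \<le> qform y x" for N x
    using y(2) by (intro iter_qform_sum_le) auto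
  from order_trans [OF this K(2)] show ?thesis
    using K(1) by (intro exI [of _ K]) simp
qed

lemma T_summableI:
  assumes "op_pos A" "\<And>N x. (\<Sum>n<N. qform ((T ^^ n) A) x) \<le> K * (norm x)\<^sup>2"
  shows "T_summable T A"
proof -
  obtain y where "op_pos y" "\<And>x. (\<lambda>n. (T ^^ n) A x) sums y x"
    by (rule potential_of_bounded [OF assms]) blast
  then show ?thesis
    unfolding T_summable_def using assms(1) by (auto intro: op_pos_bounded)
qed

lemma T_summable_dominated:
  assumes "op_pos A" "T_summable T B" "0 \<le> c" "\<And>x. qform A x \<le> c * qform B x"
  shows "T_summable T A"
proof -
  obtain K where K: "\<And>N x. (\<Sum>n<N. qform ((T ^^ n) B) x) \<le> K * (norm x)\<^sup>2"
    using T_summable_bounded [OF assms(2)] by blast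
  have "op_pos B" by (rule T_summable_pos [OF assms(2)])
  have "(\<Sum>n<N. qform ((T ^^ n) A) x) \<le> (c * K) * (norm x)\<^sup>2" for N x
  proof -
    have "(\<Sum>n<N. qform ((T ^^ n) A) x) \<le> c * (\<Sum>n<N. qform ((T ^^ n) B) x)"
      unfolding sum_distrib_left by (intro sum_mono iter_mono assms \<open>op_pos B\<close>)
    also have "\<dots> \<le> c * (K * (norm x)\<^sup>2)"
      by (intro mult_left_mono K assms)
    finally show ?thesis by (simp add: mult.assoc)
  qed
  then show ?thesis by (rule T_summableI [OF assms(1)])
qed

lemma T_summable_add:
  assumes "T_summable T A" "T_summable T B"
  shows "T_summable T (\<lambda>x. A x + B x)"
proof -
  obtain K where K: "\<And>N x. (\<Sum>n<N. qform ((T ^^ n) A) x) \<le> K * (norm x)\<^sup>2"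
    using T_summable_bounded [OF assms(1)] by blast
  obtain L where L: "\<And>N x. (\<Sum>n<N. qform ((T ^^ n) B) x) \<le> L * (norm x)\<^sup>2"
    using T_summable_bounded [OF assms(2)] by blast
  note pos = T_summable_pos [OF assms(1)] T_summable_pos [OF assms(2)]
  have "(\<Sum>n<N. qform ((T ^^ n) (\<lambda>x. A x + B x)) x) \<le> (K + L) * (norm x)\<^sup>2" for N x
    using add_mono [OF K [where N = N and x = x] L [where N = N and x = x]]
    by (simp add: iter_add op_pos_bounded pos qform_add sum.distrib distrib_right)
  then show ?thesis by (rule T_summableI [OF op_pos_add [OF pos]])
qed

text \<open>The shift only discards the first \<open>k\<close> terms of a series with nonnegative
  forms.\<close>

lemma T_summable_iter:
  assumes "T_summable T A"
  shows "T_summable T ((T ^^ k) A)"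
proof -
  obtain K where K: "\<And>N x. (\<Sum>n<N. qform ((T ^^ n) A) x) \<le> K * (norm x)\<^sup>2"
    using T_summable_bounded [OF assms] by blast
  note pos = T_summable_pos [OF assms]
  have "(\<Sum>n<N. qform ((T ^^ n) ((T ^^ k) A)) x) \<le> K * (norm x)\<^sup>2" for N x
  proof -
    have "(\<Sum>n<N. qform ((T ^^ n) ((T ^^ k) A)) x) = (\<Sum>n\<in>{k..<N + k}. qform ((T ^^ n) A) x)"
    proof -
      have "(T ^^ n) ((T ^^ k) A) = (T ^^ (n + k)) A" for n
        by (simp only: funpow_add o_apply)
      then show ?thesis
        using sum.shift_bounds_nat_ivl [of "\<lambda>n. qform ((T ^^ n) A) x" 0 k N]
        by (simp only: add_0 atLeast0LessThan)
    qed
    also have "\<dots> \<le> (\<Sum>n<N + k. qform ((T ^^ n) A) x)"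
      by (intro sum_mono2) (auto intro: op_pos_qform_nonneg iter_pos pos)
    also have "\<dots> \<le> K * (norm x)\<^sup>2" by (rule K)
    finally show ?thesis .
  qed
  then show ?thesis by (rule T_summableI [OF iter_pos [OF pos]])
qed

text \<open>By Cauchy-Schwarz for the form of \<open>A\<close>, the rank one operator is dominated
  by \<open>A\<close> itself with constant \<open>qform A z\<close>.\<close>

lemma T_summable_t_vec_range:
  assumes "T_summable T A"
  shows "T_summable T (t_vec (A z))"
proof (rule T_summable_dominated [OF t_vec_pos assms])
  note pos = T_summable_pos [OF assms]
  show "0 \<le> qform A z" by (rule op_pos_qform_nonneg [OF pos])
  show "qform (t_vec (A z)) x \<le> qform A z * qform A x" for x
    using op_pos_Cauchy_Schwarz [OF pos, of x z]
    by (simp add: t_vec_qform op_pos_selfadjoint [OF pos] mult.commute)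
qed

text \<open>For sums, the operator \<open>t_vec (\<xi> + \<zeta>)\<close> is dominated by twice the
  sum of the two rank one operators; scaling multiplies the form by
  \<open>(cmod c)\<^sup>2\<close>.\<close>

lemma csubspace_T_summable_t_vec: "csubspace {\<xi>. T_summable T (t_vec \<xi>)}"
  unfolding csubspace_def mem_Collect_eq
proof (intro conjI ballI allI, unfold mem_Collect_eq)
  show "T_summable T (t_vec 0)"
    by (rule T_summableI [of _ 0]) (simp_all add: op_pos_zero t_vec_def iter_zero qform_def)
next
  fix \<xi> \<zeta> assume "T_summable T (t_vec \<xi>)" "T_summable T (t_vec \<zeta>)"
  then have "T_summable T (\<lambda>x. t_vec \<xi> x + t_vec \<zeta> x)"
    by (rule T_summable_add)
  then show "T_summable T (t_vec (\<xi> + \<zeta>))"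
  proof (rule T_summable_dominated [OF t_vec_pos _, where c = 2])
    fix x
    have "(cmod (a + b))\<^sup>2 \<le> 2 * ((cmod a)\<^sup>2 + (cmod b)\<^sup>2)" for a b :: complex
    proof -
      have "(cmod (a + b))\<^sup>2 \<le> (cmod a + cmod b)\<^sup>2"
        by (intro power_mono norm_triangle_ineq) simp
      also have "\<dots> \<le> 2 * ((cmod a)\<^sup>2 + (cmod b)\<^sup>2)"
        using sum_squares_bound [of "cmod a" "cmod b"] by (simp add: power2_sum)
      finally show ?thesis .
    qed
    then show "qform (t_vec (\<xi> + \<zeta>)) x \<le> 2 * qform (\<lambda>x. t_vec \<xi> x + t_vec \<zeta> x) x"
      unfolding qform_add t_vec_qform cinner_add_right by blast
  qed simp
next
  fix c \<xi> assume "T_summable T (t_vec \<xi>)"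
  then show "T_summable T (t_vec (scaleC c \<xi>))"
    by (rule T_summable_dominated [OF t_vec_pos _, where c = "(cmod c)\<^sup>2"])
      (simp_all add: t_vec_qform cinner_scaleC_right norm_mult power_mult_distrib)
qed

end

section \<open>Iterates dominated by a superharmonic projection\<close>

locale markov_superharmonic = markov T
  for T :: "('h::chilbert \<Rightarrow> 'h) \<Rightarrow> ('h \<Rightarrow> 'h)" +
  fixes q :: "'h \<Rightarrow> 'h"
  assumes proj: "is_orth_proj q" and T_le: "op_le (T q) q"
begin

text \<open>Peeling off the innermost \<open>T\<close> lets the monotonicity of
  \<open>T ^^ n\<close> carry the inequality for \<open>T q\<close> forward.\<close>

lemma iter_proj_le: "qform ((T ^^ n) q) x \<le> qform q x"
proof (induction n arbitrary: x)
  case (Suc n)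
  have "qform (T q) x \<le> qform q x" for x
    using T_le by (auto simp: op_le_def op_pos_def cinner_diff_left qform_def)
  then have "qform ((T ^^ n) (T q)) x \<le> 1 * qform ((T ^^ n) q) x"
    by (intro iter_mono T_pos orth_proj_pos proj) auto
  also have "\<dots> \<le> qform q x" using Suc by simp
  finally show ?case by (simp add: funpow_Suc_right del: funpow.simps)
qed simp

lemma iter_le_proj:
  assumes "op_pos A" "0 \<le> c" "\<And>x. qform A x \<le> c * qform q x"
  shows "qform ((T ^^ n) A) x \<le> c * qform q x"
proof -
  have "qform ((T ^^ n) A) x \<le> c * qform ((T ^^ n) q) x"
    by (intro iter_mono assms orth_proj_pos proj)
  also have "\<dots> \<le> c * qform q x"
    by (intro mult_left_mono iter_proj_le assms)
  finally show ?thesis .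
qed

text \<open>Domination by a multiple of \<open>q\<close> survives iteration, so every iterate
  vanishes on the kernel of \<open>q\<close>.\<close>

lemma iter_compress:
  assumes "op_pos A" "0 \<le> c" "\<And>x. qform A x \<le> c * qform q x"
  shows "(T ^^ n) A (q x) = (T ^^ n) A x" and "q ((T ^^ n) A x) = (T ^^ n) A x"
proof -
  have "(T ^^ n) A v = 0" if "q v = 0" for v
    by (rule op_pos_kernel_mono [where B = q and c = c])
      (use assms that in \<open>auto intro: iter_pos iter_le_proj\<close>)
  then show "(T ^^ n) A (q x) = (T ^^ n) A x" "q ((T ^^ n) A x) = (T ^^ n) A x"
    using op_pos_compress [OF iter_pos [OF assms(1)] proj] by blast+
qed

text \<open>The forms of the iterates agree at \<open>x\<close> and \<open>q x\<close>, so pointwise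
  control on the range of \<open>q\<close> is pointwise control everywhere;
  \<open>op_pos_uniform_bounded\<close> makes it uniform.\<close>

lemma T_summable_t_vec_if_weakly:
  assumes "\<xi> \<in> range q" "norm \<xi> = 1"
    and sm: "\<And>\<eta>. \<eta> \<in> range q \<Longrightarrow> summable (\<lambda>n. qform ((T ^^ n) (t_vec \<xi>)) \<eta>)"
  shows "T_summable T (t_vec \<xi>)"
proof -
  let ?t = "t_vec \<xi>"
  have le: "qform ?t x \<le> 1 * qform q x" for x
    using t_vec_le_orth_proj [OF proj assms(1)] assms(2) by simp
  have red: "qform ((T ^^ n) ?t) x = qform ((T ^^ n) ?t) (q x)" for n x
    unfolding qform_def iter_compress(1) [OF t_vec_pos zero_le_one le]
      orth_proj_selfadjoint [OF proj, symmetric] iter_compress(2) [OF t_vec_pos zero_le_one le] ..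
  have "\<exists>M. \<forall>N. qform (\<lambda>x. \<Sum>n<N. (T ^^ n) ?t x) x \<le> M" for x
  proof (intro exI allI)
    fix N
    have "(\<Sum>n<N. qform ((T ^^ n) ?t) (q x)) \<le> (\<Sum>n. qform ((T ^^ n) ?t) (q x))"
      by (intro sum_le_suminf sm) (auto intro: op_pos_qform_nonneg iter_pos t_vec_pos)
    then show "qform (\<lambda>x. \<Sum>n<N. (T ^^ n) ?t x) x \<le> (\<Sum>n. qform ((T ^^ n) ?t) (q x))"
      by (simp add: qform_sum red [symmetric])
  qed
  with op_pos_sum [OF iter_pos [OF t_vec_pos]]
  obtain K where "\<And>N x. qform (\<lambda>x. \<Sum>n<N. (T ^^ n) ?t x) x \<le> K * (norm x)\<^sup>2"
    by (rule op_pos_uniform_bounded) blast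
  then show ?thesis
    by (intro T_summableI [OF t_vec_pos]) (simp add: qform_sum)
qed

text \<open>The vectors with summable rank one operator form a subspace containing the ranges of all
  \<open>T\<^sup>n x\<close> and hence are dense in the support of \<open>\<Sum>T\<^sup>n x\<close>; separability allows one to extract an
  orthonormal basis from this subspace without passing to its closure.\<close>

lemma onb_of_potential:
  assumes y: "potential T y" and supp: "range q = closure (range y)"
    and sep: "separable_set (range q)"
  shows "\<exists>B. is_onb B (range q) \<and> (\<forall>\<xi>\<in>B. T_summable T (t_vec \<xi>))"
proof -
  obtain x where x: "T_summable T x" "\<And>\<eta>. (\<lambda>n. (T ^^ n) x \<eta>) sums y \<eta>" and ypos: "op_pos y"
    using y by (auto simp: potential_def)
  have xpos: "op_pos ((T ^^ k) x)" for k
    by (intro iter_pos T_summable_pos x(1))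
  have le: "qform ((T ^^ k) x) v \<le> 1 * qform y v" for k v
    using iter_qform_sum_le [OF xpos [of 0, simplified] x(2), of "{k}" v] by simp
  \<comment> \<open>\<open>q v = 0\<close> makes \<open>v\<close> orthogonal to the range of
    \<open>q\<close>, which contains the range of \<open>y\<close>; self-adjointness moves
    \<open>y\<close> across.\<close>
  have "y v = 0" if "q v = 0" for v
  proof (rule cinner_eqI)
    fix w
    have "y w \<in> range q" unfolding supp using subsetD [OF closure_subset rangeI] .
    then show "cinner (y v) w = cinner 0 w"
      using orth_proj_orth [OF proj, of "y w" v] that by (simp add: op_pos_selfadjoint [OF ypos])
  qed
  then have "(T ^^ k) x v = 0" if "q v = 0" for k v
    using op_pos_kernel_mono [where B = y, OF xpos _ le] that by blast
  note compress = op_pos_compress [OF xpos proj this]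
  obtain D where D: "countable D" "range q \<subseteq> closure D"
    using sep by (auto simp: separable_set_def)
  \<comment> \<open>Countably many vectors suffice: each \<open>(T ^^ k) x\<close> is continuous and
    depends only on the component in the range of \<open>q\<close>, where points of \<open>D\<close>
    approximate.\<close>
  define E where "E = (\<Union>k. (T ^^ k) x ` D)"
  have E: "cspan E \<subseteq> range q" "cspan E \<subseteq> {\<xi>. T_summable T (t_vec \<xi>)}"
  proof -
    show "cspan E \<subseteq> range q"
      using compress(2) orth_proj_range_iff [OF proj]
      by (intro cspan_minimal csubspace_range orth_proj_clinear proj) (auto simp: E_def)
    show "cspan E \<subseteq> {\<xi>. T_summable T (t_vec \<xi>)}"
      by (intro cspan_minimal csubspace_T_summable_t_vec)
        (auto simp: E_def intro: T_summable_t_vec_range T_summable_iter x)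
  qed
  have "range y \<subseteq> closure (cspan E)"
  proof safe
    fix \<eta>
    have "(T ^^ k) x \<eta> \<in> closure (cspan E)" for k
    proof -
      have "(T ^^ k) x ` D \<subseteq> closure (cspan E)"
        using cspan_superset [of E] closure_subset [of "cspan E"] by (auto simp: E_def)
      then have "(T ^^ k) x ` closure D \<subseteq> closure (cspan E)"
        by (intro image_closure_subset linear_continuous_on bounded_op_bounded_linear
            op_pos_bounded xpos closed_closure)
      moreover have "q \<eta> \<in> closure D" using D(2) by blast
      ultimately have "(T ^^ k) x (q \<eta>) \<in> closure (cspan E)" by blast
      then show ?thesis by (simp add: compress(1))
    qed
    then have "(\<Sum>k<N. (T ^^ k) x \<eta>) \<in> closure (cspan E)" for N
      by (intro csubspace_sum csubspace_closure csubspace_cspan)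
    then show "y \<eta> \<in> closure (cspan E)"
      by (rule closed_sequentially [OF closed_closure _ x(2) [unfolded sums_def]])
  qed
  then have "range q \<subseteq> closure (cspan E)"
    unfolding supp by (intro closure_minimal closed_closure)
  moreover have "closure (cspan E) \<subseteq> range q"
    using E(1) by (intro closure_minimal orth_proj_closed_range proj)
  ultimately have clE: "closure (cspan E) = range q" by blast
  have "countable E"
    using D(1) by (auto simp: E_def)
  then obtain B where B: "orthonormal B" "cspan B = cspan E"
    by (rule orthonormal_spanning_exists)
  \<comment> \<open>Equality of the algebraic spans places \<open>B\<close> in
    \<open>cspan E\<close> itself, where summability is known, and not merely in its
    closure.\<close>
  have BE: "B \<subseteq> cspan E" using cspan_superset [of B] by (simp add: B(2))
  show ?thesis
  proof (intro exI conjI ballI)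
    show "is_onb B (range q)"
      using B clE BE E(1) by (auto simp: is_onb_orthonormal)
    show "T_summable T (t_vec \<xi>)" if "\<xi> \<in> B" for \<xi>
      using that BE E(2) by blast
  qed
qed

text \<open>A summable operator is built as \<open>\<Sum>c\<^sub>j t\<^bsub>e j\<^esub>\<close> where the weights \<open>c\<^sub>j\<close> decay fast enough
  to compensate the norms of the potentials of the \<open>t\<^bsub>e j\<^esub>\<close>. The zero vector is added to the
  basis so that it can be enumerated (with repetitions) even when it is finite or empty.\<close>

lemma potential_of_onb:
  assumes B: "is_onb B (range q)" "\<And>\<xi>. \<xi> \<in> B \<Longrightarrow> T_summable T (t_vec \<xi>)"
    and sep: "separable_set (range q)"
  obtains y where "potential T y" "range q = closure (range y)"
proof -
  have "countable B"
    using B(1) sep orthonormal_countable by (auto simp: is_onb_orthonormal)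
  define e where "e = from_nat_into (insert 0 B)"
  have re: "range e = insert 0 B"
    using \<open>countable B\<close> by (simp add: e_def)
  have ej: "e j \<in> insert 0 B" for j
    using re by blast
  have e_le: "qform (t_vec (e j)) x \<le> qform q x" for j x
  proof (rule t_vec_le_orth_proj [OF proj])
    show "e j \<in> range q"
      using ej [of j] B(1) csubspace_0 [OF csubspace_range [OF orth_proj_clinear [OF proj]]]
      by (auto simp: is_onb_def)
    show "norm (e j) \<le> 1"
      using ej [of j] B(1) by (auto simp: is_onb_def)
  qed
  have "T_summable T (t_vec (e j))" for j
    using ej [of j] B(2) csubspace_0 [OF csubspace_T_summable_t_vec] by auto
  then have "\<exists>K\<ge>0. \<forall>N x. (\<Sum>n<N. qform ((T ^^ n) (t_vec (e j))) x) \<le> K * (norm x)\<^sup>2" for j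
    by (rule T_summable_bounded)
  then obtain K where K0: "\<And>j. 0 \<le> K j"
    and K: "\<And>j N x. (\<Sum>n<N. qform ((T ^^ n) (t_vec (e j))) x) \<le> K j * (norm x)\<^sup>2"
    by metis
  \<comment> \<open>One weight gives two bounds: \<open>c j \<le> (1/2)^j\<close> makes the
    operators \<open>X m\<close> converge, and \<open>c j * K j \<le> (1/2)^j\<close> bounds the
    partial sums of their orbits uniformly in \<open>m\<close>.\<close>
  define c where "c j = (1/2)^j / (1 + K j)" for j
  have c_pos: "0 < c j" for j
    using K0 [of j] by (simp add: c_def)
  have c_le: "c j \<le> (1/2)^j" for j
    using K0 [of j] by (simp add: c_def divide_le_eq)
  have cK_le: "c j * K j \<le> (1/2)^j" for j
    using K0 [of j] by (simp add: c_def divide_le_eq)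
  define X where "X m = (\<lambda>x. \<Sum>j<m. scaleC (of_real (c j)) (t_vec (e j) x))" for m
  have Xpos: "op_pos (X m)" for m
    unfolding X_def using c_pos less_imp_le by (intro op_pos_sum op_pos_scaleC t_vec_pos) blast
  have X_qform: "qform (X m) x = (\<Sum>j<m. c j * qform (t_vec (e j)) x)" for m x
    by (simp add: X_def qform_sum qform_scaleC)
  have Xinc: "incseq (\<lambda>m. qform (X m) x)" for x
    by (intro incseq_SucI) (simp add: X_qform c_pos less_imp_le op_pos_qform_nonneg t_vec_pos)
  have q0: "0 \<le> qform q x" for x
    by (intro op_pos_qform_nonneg orth_proj_pos proj)
  \<comment> \<open>The tail of the series is dominated by the tail of the geometric series times \<open>q\<close>.\<close>
  have Xdec: "decseq (\<lambda>m. qform (X m) x + 2 * (1/2)^m * qform q x)" for x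
  proof (rule decseq_SucI)
    fix m
    have "c m * qform (t_vec (e m)) x \<le> (1/2)^m * qform q x"
      using c_pos [of m] by (intro mult_mono c_le e_le op_pos_qform_nonneg t_vec_pos) auto
    then show "qform (X (Suc m)) x + 2 * (1/2)^Suc m * qform q x
        \<le> qform (X m) x + 2 * (1/2)^m * qform q x"
      by (simp add: X_qform mult.commute)
  qed
  have Xle: "qform (X m) x \<le> 2 * qform q x" for m x
  proof -
    have "qform (X m) x + 2 * (1/2)^m * qform q x \<le> 2 * qform q x"
      using decseqD [OF Xdec [of x], of 0 m] by (simp add: X_qform)
    moreover have "0 \<le> 2 * (1/2)^m * qform q x"
      using q0 by simp
    ultimately show ?thesis by linarith
  qed
  have "qform (X m) x \<le> 2 * (norm x)\<^sup>2" for m x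
    using Xle [of m x] orth_proj_qform_le [OF proj, of x] by linarith
  then obtain x\<^sub>0 where x0: "op_pos x\<^sub>0" "\<And>x. (\<lambda>m. X m x) \<longlonglongrightarrow> x\<^sub>0 x"
    and X_le_x0: "\<And>m x. qform (X m) x \<le> qform x\<^sub>0 x"
    by (rule op_pos_incseq_LIMSEQ [OF Xpos Xinc]) blast
  have lim: "(\<lambda>m. qform (X m) x) \<longlonglongrightarrow> qform x\<^sub>0 x" for x
    by (intro tendsto_qform x0)
  have half: "(\<lambda>m. b * (1/2)^m * a) \<longlonglongrightarrow> 0" for a b :: real
    using tendsto_mult_left_zero [OF tendsto_mult_right_zero [OF LIMSEQ_power_zero [of "1/2::real"]]]
    by simp
  \<comment> \<open>A decreasing sequence stays above its limit, which estimates the tail beyond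
    \<open>X m\<close>.\<close>
  have x0_le_X: "qform x\<^sub>0 x \<le> qform (X m) x + 2 * (1/2)^m * qform q x" for m x
  proof -
    have "(\<lambda>m. qform (X m) x + 2 * (1/2)^m * qform q x) \<longlonglongrightarrow> qform x\<^sub>0 x + 0"
      by (intro tendsto_add lim half)
    from decseq_ge [OF Xdec this, of m] show ?thesis by simp
  qed
  have x0_le: "qform x\<^sub>0 x \<le> 2 * qform q x" for x
    using x0_le_X [of x 0] by (simp add: X_qform)
  have "(\<Sum>n<N. qform ((T ^^ n) x\<^sub>0) x) \<le> 2 * (norm x)\<^sup>2" for N x
  proof -
    \<comment> \<open>For fixed \<open>N\<close>, truncation at \<open>m\<close> costs an error
      proportional to \<open>(1/2)^m\<close>. Letting \<open>m\<close> grow removes it, while the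
      main term is bounded independently of \<open>m\<close> and \<open>N\<close>.\<close>
    have "(\<Sum>n<N. qform ((T ^^ n) x\<^sub>0) x)
        \<le> 2 * (norm x)\<^sup>2 + real N * (2 * (1/2)^m * qform q x)" for m
    proof -
      let ?\<epsilon> = "2 * (1/2)^m :: real"
      have iter_X: "qform ((T ^^ n) (X m)) x = (\<Sum>j<m. c j * qform ((T ^^ n) (t_vec (e j))) x)" for n
        by (simp add: X_def iter_sum bounded_op_scaleC op_pos_bounded t_vec_pos iter_scaleC
            qform_sum qform_scaleC)
      have "(\<Sum>n<N. qform ((T ^^ n) (X m)) x)
          = (\<Sum>j<m. c j * (\<Sum>n<N. qform ((T ^^ n) (t_vec (e j))) x))"
        unfolding iter_X sum_distrib_left by (rule sum.swap)
      also have "\<dots> \<le> (\<Sum>j<m. (1/2)^j * (norm x)\<^sup>2)"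
      proof (rule sum_mono)
        fix j
        have "c j * (\<Sum>n<N. qform ((T ^^ n) (t_vec (e j))) x) \<le> c j * (K j * (norm x)\<^sup>2)"
          by (intro mult_left_mono K less_imp_le c_pos)
        also have "\<dots> \<le> (1/2)^j * (norm x)\<^sup>2"
          using mult_right_mono [OF cK_le, of "(norm x)\<^sup>2" j] by (simp add: mult.assoc)
        finally show "c j * (\<Sum>n<N. qform ((T ^^ n) (t_vec (e j))) x) \<le> (1/2)^j * (norm x)\<^sup>2" .
      qed
      also have "\<dots> = (\<Sum>j<m. (1/2)^j) * (norm x)\<^sup>2"
        by (rule sum_distrib_right [symmetric])
      also have "\<dots> \<le> 2 * (norm x)\<^sup>2"
        using sum_gp_strict [of "1/2::real" m] by (intro mult_right_mono) auto
      finally have X_bound: "(\<Sum>n<N. qform ((T ^^ n) (X m)) x) \<le> 2 * (norm x)\<^sup>2" .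
      \<comment> \<open>The tail is dominated by a small multiple of \<open>q\<close>, and iteration
        does not enlarge \<open>q\<close>, so the error is uniform in \<open>n\<close>.\<close>
      have "qform ((T ^^ n) x\<^sub>0) x \<le> qform ((T ^^ n) (X m)) x + ?\<epsilon> * qform q x" for n
      proof -
        let ?q = "\<lambda>x. scaleC (of_real ?\<epsilon>) (q x)"
        have qpos: "op_pos ?q"
          by (intro op_pos_scaleC orth_proj_pos proj) simp
        have "qform ((T ^^ n) x\<^sub>0) x \<le> 1 * qform ((T ^^ n) (\<lambda>x. X m x + ?q x)) x"
        proof (rule iter_mono [OF x0(1) op_pos_add [OF Xpos qpos]])
          show "qform x\<^sub>0 x \<le> 1 * qform (\<lambda>x. X m x + ?q x) x" for x
            unfolding qform_add qform_scaleC using x0_le_X by simp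
        qed simp
        also have "\<dots> = qform ((T ^^ n) (X m)) x + ?\<epsilon> * qform ((T ^^ n) q) x"
          unfolding iter_add [OF op_pos_bounded [OF Xpos] op_pos_bounded [OF qpos]]
            iter_scaleC [OF op_pos_bounded [OF orth_proj_pos [OF proj]]] qform_add qform_scaleC
          by simp
        also have "\<dots> \<le> qform ((T ^^ n) (X m)) x + ?\<epsilon> * qform q x"
          by (intro add_left_mono mult_left_mono iter_proj_le) simp
        finally show ?thesis .
      qed
      then have "(\<Sum>n<N. qform ((T ^^ n) x\<^sub>0) x)
          \<le> (\<Sum>n<N. qform ((T ^^ n) (X m)) x + ?\<epsilon> * qform q x)"
        by (intro sum_mono)
      then show ?thesis
        using X_bound by (simp add: sum.distrib)
    qed
    moreover have "(\<lambda>m. 2 * (norm x)\<^sup>2 + real N * (2 * (1/2)^m * qform q x)) \<longlonglongrightarrow> 2 * (norm x)\<^sup>2 + real N * 0"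
      by (intro tendsto_intros half)
    ultimately have "(\<Sum>n<N. qform ((T ^^ n) x\<^sub>0) x) \<le> 2 * (norm x)\<^sup>2 + real N * 0"
      by (intro LIMSEQ_le_const) auto
    then show ?thesis by simp
  qed
  then obtain y where y: "op_pos y" "\<And>x. (\<lambda>n. (T ^^ n) x\<^sub>0 x) sums y x"
    by (rule potential_of_bounded [OF x0(1)]) blast
  have pot: "potential T y"
    unfolding potential_def T_summable_def using y x0(1) op_pos_bounded by blast
  \<comment> \<open>Every term of the series is dominated by a multiple of \<open>q\<close> and so
    vanishes on its kernel.\<close>
  have "y v = 0" if "q v = 0" for v
  proof -
    have "(T ^^ n) x\<^sub>0 v = 0" for n
      by (rule op_pos_kernel_mono [where B = q and c = 2])
        (use x0(1) x0_le that in \<open>auto intro: iter_pos iter_le_proj\<close>)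
    then show ?thesis
      using y(2) [of v] by (simp add: sums_iff)
  qed
  note compress = op_pos_compress [OF y(1) proj this]
  have "closure (range y) \<subseteq> range q"
    using compress(2) orth_proj_range_iff [OF proj]
    by (intro closure_minimal orth_proj_closed_range proj) auto
  moreover have "range q \<subseteq> closure (range y)"
  proof
    fix \<eta> assume \<eta>: "\<eta> \<in> range q"
    obtain p where p: "is_orth_proj p" "range p = closure (range y)"
      using orth_proj_exists [OF csubspace_closure [OF csubspace_range
            [OF op_pos_clinear [OF y(1)]]] closed_closure] .
    \<comment> \<open>This is the part of \<eta> orthogonal to the closure of the range of
      \<open>y\<close>; it vanishes once it is orthogonal to all of \<open>B\<close>.\<close>
    define v where "v = \<eta> - p \<eta>"
    have "p \<eta> \<in> range q"
      using p(2) \<open>closure (range y) \<subseteq> range q\<close> by blast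
    then have vq: "v \<in> range q"
      unfolding v_def by (intro csubspace_diff csubspace_range orth_proj_clinear proj \<eta>)
    have "cinner v (y w) = 0" for w
      unfolding v_def
      by (rule orth_proj_orth [OF p(1)]) (use p(2) closure_subset [of "range y"] in blast)
    then have "y v = 0"
      using op_pos_selfadjoint [OF y(1), of v "y v"] by simp
    \<comment> \<open>The term for \<open>n = 0\<close> of the series for \<open>y\<close> is
      \<open>x\<^sub>0\<close> itself.\<close>
    moreover have "qform x\<^sub>0 v \<le> 1 * qform y v"
      using iter_qform_sum_le [OF x0(1) y(2), of "{0}" v] by simp
    ultimately have x0v: "qform x\<^sub>0 v \<le> 0" by (simp add: qform_def)
    have "cinner v b = 0" if "b \<in> B" for b
    proof -
      have "b \<in> range e" using that by (simp add: re)
      then obtain j where j: "b = e j" by (rule rangeE)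
      \<comment> \<open>\<open>X m\<close> sums over indices below \<open>m\<close>, so
        \<open>Suc j\<close> is the first stage containing the term of \<open>e j\<close>.\<close>
      have "c j * qform (t_vec (e j)) v \<le> qform (X (Suc j)) v"
        unfolding X_qform using c_pos
        by (simp add: sum_nonneg less_imp_le op_pos_qform_nonneg t_vec_pos)
      then have "c j * qform (t_vec (e j)) v \<le> 0"
        using X_le_x0 [of "Suc j" v] x0v by linarith
      then have "qform (t_vec (e j)) v \<le> 0"
        using c_pos [of j] by (simp add: mult_le_0_iff)
      then show ?thesis by (simp add: t_vec_qform j)
    qed
    then have "v = 0"
      using is_onb_orthogonal_eq_0 [OF B(1) vq] by blast
    then have "\<eta> = p \<eta>" by (simp add: v_def)
    then show "\<eta> \<in> closure (range y)"
      unfolding p(2) [symmetric] by (rule range_eqI)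
  qed
  ultimately show thesis using that pot by blast
qed

end

theorem theorem4p8:
  fixes T :: "('h::chilbert \<Rightarrow> 'h) \<Rightarrow> ('h \<Rightarrow> 'h)"
    and q :: "'h \<Rightarrow> 'h"
  assumes "markov_op T"
    and "is_orth_proj q"
    and "op_le (T q) q"
    and "separable_set (range q)"
  shows "((\<exists>y. potential T y \<and> q = supp y) \<longleftrightarrow>
          (\<exists>B. is_onb B (range q) \<and> (\<forall>\<xi>\<in>B. T_summable T (t_vec \<xi>)))) \<and>
         ((\<exists>B. is_onb B (range q) \<and> (\<forall>\<xi>\<in>B. T_summable T (t_vec \<xi>))) \<longleftrightarrow>
          (\<exists>B. is_onb B (range q) \<and> (\<forall>\<xi>\<in>B. \<forall>\<eta>\<^sub>0\<in>range q.
              summable (\<lambda>n. Re (cinner ((T ^^ n) (t_vec \<xi>) \<eta>\<^sub>0) \<eta>\<^sub>0)))))"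
proof -
  interpret markov_superharmonic T q
    by unfold_locales (fact assms)+
  have supp: "q = supp y \<longleftrightarrow> range q = closure (range y)" if "potential T y" for y
    using that by (intro supp_eq_iff proj) (auto simp: potential_def op_pos_bounded)
  have i_ii: "(\<exists>y. potential T y \<and> q = supp y) \<longleftrightarrow>
      (\<exists>B. is_onb B (range q) \<and> (\<forall>\<xi>\<in>B. T_summable T (t_vec \<xi>)))"
  proof (intro iffI; elim exE conjE)
    fix y assume "potential T y" "q = supp y"
    with supp have "range q = closure (range y)" by blast
    from onb_of_potential [OF \<open>potential T y\<close> this assms(4)]
    show "\<exists>B. is_onb B (range q) \<and> (\<forall>\<xi>\<in>B. T_summable T (t_vec \<xi>))" .
  next
    fix B assume "is_onb B (range q)" "\<forall>\<xi>\<in>B. T_summable T (t_vec \<xi>)"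
    then obtain y where "potential T y" "range q = closure (range y)"
      using potential_of_onb [OF _ _ assms(4), of B] by auto
    with supp show "\<exists>y. potential T y \<and> q = supp y" by blast
  qed
  \<comment> \<open>The equivalence holds vector by vector, so the last two conditions can be
    compared on one and the same basis.\<close>
  have ii_iii: "T_summable T (t_vec \<xi>) \<longleftrightarrow>
      (\<forall>\<eta>\<^sub>0\<in>range q. summable (\<lambda>n. Re (cinner ((T ^^ n) (t_vec \<xi>) \<eta>\<^sub>0) \<eta>\<^sub>0)))"
    if "is_onb B (range q)" "\<xi> \<in> B" for B \<xi>
  proof
    assume "T_summable T (t_vec \<xi>)"
    then show "\<forall>\<eta>\<^sub>0\<in>range q. summable (\<lambda>n. Re (cinner ((T ^^ n) (t_vec \<xi>) \<eta>\<^sub>0) \<eta>\<^sub>0))"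
      using iter_qform_sums by (auto simp: T_summable_def qform_def sums_iff)
  next
    assume "\<forall>\<eta>\<^sub>0\<in>range q. summable (\<lambda>n. Re (cinner ((T ^^ n) (t_vec \<xi>) \<eta>\<^sub>0) \<eta>\<^sub>0))"
    then show "T_summable T (t_vec \<xi>)"
      using that by (intro T_summable_t_vec_if_weakly) (auto simp: is_onb_def qform_def)
  qed
  show ?thesis
    by (intro conjI i_ii ex_cong1 conj_cong refl ball_cong ii_iii)
qed

end
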